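(* Let $A$ be a finite set, $n\ge 3$, and let $\sigma\subseteq A^n$ be a core (of some essential key relation) whose pattern is full and which is preserved by a WNU vector-function. Suppose $A_1\times\dots\times A_n$ (with $A_i\subseteq A$) is a key block of $\sigma$. Then there exist a finite field $F$ and bijections $\phi_i:A_i\to F$ ($i=1,\dots,n$) such that $$\sigma\cap(A_1\times\dots\times A_n)=\{(x_1,\dots,x_n):\ \phi_1(x_1)+\dots+\phi_n(x_n)=0\}.$$
   Context: A unary vector-function is a tuple $\Psi=(\psi_1,\dots,\psi_n)$ of maps $\psi_i:A\to A$ acting coordinatewise; it preserves $\rho$ if $\Psi(\rho)\subseteq\rho$; $\Psi\circ\Psi'$ denotes coordinatewise composition. $\rho\subseteq A^n$ is a key relation if there is $\beta\in A^n\setminus\rho$ (a key tuple) such that every $\alpha\in A^n\setminus\rho$ is mapped to $\beta$ by some unary vector-function preserving $\rho$; $\rho$ is essential if it cannot be written as a conjunction of relations of smaller arities. Core: given a key relation $\rho$, a relation $\sigma\subseteq\rho$ is a core of $\rho$ if there is a unary vector-function $\Psi$ such that (1) $\Psi$ preserves $\rho$; (2) $\Psi(\alpha)=\alpha$ for some key tuple $\alpha$ of $\rho$; (3) $\Psi(\rho)=\sigma$; (4) $\Psi\circ\Psi=\Psi$; (5) there is no unary vector-function $\Psi'$ satisfying (1)–(4) with $\Psi'(A^n)\subsetneq\Psi(A^n)$. $\mathrm{Key}(\sigma)$ denotes $\sigma$ together with all its key tuples. Consider the graph on $\mathrm{Key}(\sigma)$ where two tuples are adjacent if they differ in exactly one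 coordinate; a key block of $\sigma$ is a connected component of this graph containing a key tuple of $\sigma$. The pattern of $\sigma$: for $i\ne j$, $i\overset{\sigma}{\sim}j$ iff there do NOT exist $a_1,\dots,a_n,b_i,b_j$ with $(a_1,\dots,a_n)\notin\sigma$ while the tuples obtained by replacing $a_i$ by $b_i$, $a_j$ by $b_j$, and both, all lie in $\sigma$; full means $i\overset{\sigma}{\sim}j$ for all $i,j$. A WNU is an $m$-ary ($m\ge2$) operation $f$ with $f(x,\dots,x)=x$ and $f(y,x,\dots,x)=\dots=f(x,\dots,x,y)$; a WNU vector-function is a tuple $(f_1,\dots,f_n)$ of $m$-ary WNUs, preserving $\sigma$ if applying $f_i$ to the $i$-th coordinates of any $m$ tuples of $\sigma$ yields a tuple in $\sigma$.
   Formalization: In condition (5) of a core, Ψ' ranges over all vector-functions satisfying (1), (2) and (4), without requiring Ψ'(ρ)=σ for the same σ; with σ fixed in (3) the claim fails (e.g. A=Z₂×{0,1}, n=3, ρ: first components sum to 0). *)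

theory Defs
  imports "HOL-Algebra.Algebra"
begin

text \<open>Tuples in A^n are lists of length n with entries in A; coordinates are 0..n-1.
 A unary vector-function is a family of maps indexed by the coordinate.\<close>

definition tuples :: "'a set \<Rightarrow> nat \<Rightarrow> 'a list set" where
  "tuples A n = {xs. length xs = n \<and> set xs \<subseteq> A}"

definition vapply :: "(nat \<Rightarrow> 'a \<Rightarrow> 'a) \<Rightarrow> 'a list \<Rightarrow> 'a list" where
  "vapply \<Psi> xs = map (\<lambda>i. \<Psi> i (xs ! i)) [0..<length xs]"

definition uvf :: "'a set \<Rightarrow> nat \<Rightarrow> (nat \<Rightarrow> 'a \<Rightarrow> 'a) \<Rightarrow> bool" where
  "uvf A n \<Psi> \<longleftrightarrow> (\<forall>i<n. \<forall>x\<in>A. \<Psi> i x \<in> A)"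

definition preserves :: "(nat \<Rightarrow> 'a \<Rightarrow> 'a) \<Rightarrow> 'a list set \<Rightarrow> bool" where
  "preserves \<Psi> \<rho> \<longleftrightarrow> (\<forall>xs\<in>\<rho>. vapply \<Psi> xs \<in> \<rho>)"

definition key_tuple :: "'a set \<Rightarrow> nat \<Rightarrow> 'a list set \<Rightarrow> 'a list \<Rightarrow> bool" where
  "key_tuple A n \<rho> \<beta> \<longleftrightarrow> \<beta> \<in> tuples A n - \<rho> \<and>
     (\<forall>\<alpha>\<in>tuples A n - \<rho>. \<exists>\<Psi>. uvf A n \<Psi> \<and> preserves \<Psi> \<rho> \<and> vapply \<Psi> \<alpha> = \<beta>)"

definition key_relation :: "'a set \<Rightarrow> nat \<Rightarrow> 'a list set \<Rightarrow> bool" where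
  "key_relation A n \<rho> \<longleftrightarrow> \<rho> \<subseteq> tuples A n \<and> (\<exists>\<beta>. key_tuple A n \<rho> \<beta>)"

definition is_smaller_conj :: "'a set \<Rightarrow> nat \<Rightarrow> 'a list set \<Rightarrow> bool" where
  "is_smaller_conj A n \<rho> \<longleftrightarrow> (\<exists>C :: (nat list \<times> 'a list set) set.
     (\<forall>(is, \<tau>)\<in>C. length is < n \<and> set is \<subseteq> {..<n} \<and> \<tau> \<subseteq> tuples A (length is)) \<and>
     \<rho> = {xs\<in>tuples A n. \<forall>(is, \<tau>)\<in>C. map (\<lambda>j. xs ! j) is \<in> \<tau>})"

definition essential :: "'a set \<Rightarrow> nat \<Rightarrow> 'a list set \<Rightarrow> bool" where
  "essential A n \<rho> \<longleftrightarrow> \<rho> \<subseteq> tuples A n \<and> \<not> is_smaller_conj A n \<rho>"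

definition core_fun :: "'a set \<Rightarrow> nat \<Rightarrow> 'a list set \<Rightarrow> (nat \<Rightarrow> 'a \<Rightarrow> 'a) \<Rightarrow> bool" where
  "core_fun A n \<rho> \<Psi> \<longleftrightarrow> uvf A n \<Psi> \<and> preserves \<Psi> \<rho> \<and>
     (\<exists>\<alpha>. key_tuple A n \<rho> \<alpha> \<and> vapply \<Psi> \<alpha> = \<alpha>) \<and>
     (\<forall>i<n. \<forall>x\<in>A. \<Psi> i (\<Psi> i x) = \<Psi> i x)"

definition is_core :: "'a set \<Rightarrow> nat \<Rightarrow> 'a list set \<Rightarrow> 'a list set \<Rightarrow> bool" where
  "is_core A n \<rho> \<sigma> \<longleftrightarrow> \<sigma> \<subseteq> \<rho> \<and> (\<exists>\<Psi>. core_fun A n \<rho> \<Psi> \<and> vapply \<Psi> ` \<rho> = \<sigma> \<and>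
     \<not> (\<exists>\<Psi>'. core_fun A n \<rho> \<Psi>' \<and> vapply \<Psi>' ` tuples A n \<subset> vapply \<Psi> ` tuples A n))"

definition Key :: "'a set \<Rightarrow> nat \<Rightarrow> 'a list set \<Rightarrow> 'a list set" where
  "Key A n \<sigma> = \<sigma> \<union> {\<beta>. key_tuple A n \<sigma> \<beta>}"

definition adjacent :: "nat \<Rightarrow> 'a list \<Rightarrow> 'a list \<Rightarrow> bool" where
  "adjacent n xs ys \<longleftrightarrow> length xs = n \<and> length ys = n \<and> card {i. i < n \<and> xs ! i \<noteq> ys ! i} = 1"

definition key_block :: "'a set \<Rightarrow> nat \<Rightarrow> 'a list set \<Rightarrow> 'a list set \<Rightarrow> bool" where
  "key_block A n \<sigma> B \<longleftrightarrow> (\<exists>\<beta>. key_tuple A n \<sigma> \<beta> \<and>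
     B = {ys. (\<lambda>x y. x \<in> Key A n \<sigma> \<and> y \<in> Key A n \<sigma> \<and> adjacent n x y)\<^sup>*\<^sup>* \<beta> ys})"

definition pattern_rel :: "'a set \<Rightarrow> nat \<Rightarrow> 'a list set \<Rightarrow> nat \<Rightarrow> nat \<Rightarrow> bool" where
  "pattern_rel A n \<sigma> i j \<longleftrightarrow> \<not> (\<exists>a\<in>tuples A n. \<exists>bi\<in>A. \<exists>bj\<in>A. a \<notin> \<sigma> \<and>
     a[i := bi] \<in> \<sigma> \<and> a[j := bj] \<in> \<sigma> \<and> a[i := bi, j := bj] \<in> \<sigma>)"

definition full_pattern :: "'a set \<Rightarrow> nat \<Rightarrow> 'a list set \<Rightarrow> bool" where
  "full_pattern A n \<sigma> \<longleftrightarrow> (\<forall>i<n. \<forall>j<n. i \<noteq> j \<longrightarrow> pattern_rel A n \<sigma> i j)"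

text \<open>m-ary operations on A are represented as functions on lists of length m.\<close>
definition wnu :: "'a set \<Rightarrow> nat \<Rightarrow> ('a list \<Rightarrow> 'a) \<Rightarrow> bool" where
  "wnu A m f \<longleftrightarrow> m \<ge> 2 \<and> (\<forall>xs\<in>tuples A m. f xs \<in> A) \<and>
     (\<forall>x\<in>A. f (replicate m x) = x) \<and>
     (\<forall>x\<in>A. \<forall>y\<in>A. \<forall>k<m. f ((replicate m x)[k := y]) = f ((replicate m x)[0 := y]))"

definition wnu_vf_preserves :: "'a set \<Rightarrow> nat \<Rightarrow> nat \<Rightarrow> (nat \<Rightarrow> 'a list \<Rightarrow> 'a) \<Rightarrow> 'a list set \<Rightarrow> bool" where
  "wnu_vf_preserves A n m F \<sigma> \<longleftrightarrow> (\<forall>i<n. wnu A m (F i)) \<and>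
     (\<forall>ts. length ts = m \<and> set ts \<subseteq> \<sigma> \<longrightarrow>
        map (\<lambda>i. F i (map (\<lambda>t. t ! i) ts)) [0..<n] \<in> \<sigma>)"

definition prod_set :: "nat \<Rightarrow> (nat \<Rightarrow> 'a set) \<Rightarrow> 'a list set" where
  "prod_set n As = {xs. length xs = n \<and> (\<forall>i<n. xs ! i \<in> As i)}"

end

theory Submission
  imports Defs "HOL-Number_Theory.Residues"
begin

text \<open>Minimality of the core makes every unary vector-function that preserves \<open>\<sigma>\<close> either injective on
  the coordinates of the core or a map sending all key tuples into \<open>\<sigma>\<close>. Full pattern means that \<open>\<sigma>\<close> is
  rectangular in any two coordinates. If \<open>f\<close> is the WNU and \<open>s\<close> a tuple of \<open>\<sigma>\<close> in the block, then
  \<open>x \<mapsto> f(x, s, \<dots>, s)\<close> is of the first kind: otherwise rectangularity moves the arguments \<open>s\<close>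
  independently through \<open>\<sigma>\<close>, and interpolating between two neighbours of a key tuple \<open>\<beta>\<close> yields
  \<open>\<beta> = f(\<beta>, \<dots>, \<beta>) \<in> \<sigma>\<close>. Together with the WNU identity this shows that two members of \<open>\<sigma>\<close> on one line of
  the block are interchangeable everywhere, hence equal, so \<open>\<sigma>\<close> is the graph of a quasigroup operation on
  the block. After fixing a base point it is a loop on which \<open>f\<close> acts as a homomorphism, which forces the
  medial law and thus an abelian group. Multiplication by a natural number is, up to a bijection, a
  polynomial of \<open>f\<close>, so the dichotomy makes it zero or injective; hence the exponent is prime and the group
  is the additive group of a finite field.\<close>

section \<open>Finite fields of prime power order\<close>

text \<open>The dichotomy comes from a round trip. A key tuple \<alpha> fixed by the core map is
  carried to \<beta>, then by the given map to another tuple outside \<rho>, and then back to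
  \<alpha>. An idempotent power of this composite is again a candidate for the core map, so
  minimality makes it the identity on the coordinates of the core. By finiteness an injective map
  permutes \<sigma> and hence reflects membership in \<sigma>; this is the form in which the
  dichotomy is mostly used. The bound 3 on \<open>n\<close> matters in two places: a move of two
  coordinates of one argument must leave a third coordinate in which another argument can be
  disturbed, and the loop operation combines values carried by coordinates 1 and 2 into coordinate
  0. The equation to be reached uses only the additive group of the field, so any field with the
  right number of elements will do once the group is elementary abelian. It is obtained as the set
  of roots of X^q = X in an algebraic closure of the integers mod p.\<close>

lemma (in cring) binomial_expansion:
  assumes x: "x \<in> carrier R" and y: "y \<in> carrier R"
  shows "(x \<oplus> y) [^] (n::nat) = (\<Oplus>i\<in>{..n}. add_pow R (n choose i) (x [^] i \<otimes> y [^] (n - i)))"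
proof (induction n)
  case 0
  show ?case using x y by simp
next
  case (Suc n)
  define U where "U i = add_pow R (n choose i) (x [^] i \<otimes> y [^] (Suc n - i))" for i
  define V where "V i = add_pow R (n choose i) (x [^] Suc i \<otimes> y [^] (n - i))" for i
  have UV: "U i \<in> carrier R" "V i \<in> carrier R" for i using x y by (auto simp: U_def V_def)
  let ?S = "\<Oplus>i\<in>{..n}. add_pow R (n choose i) (x [^] i \<otimes> y [^] (n - i))"
  have S: "?S \<in> carrier R" using x y by (intro finsum_closed) auto
  have xS: "x \<otimes> ?S = (\<Oplus>i\<in>{..n}. V i)"
  proof -
    have "x \<otimes> ?S = (\<Oplus>i\<in>{..n}. x \<otimes> (add_pow R (n choose i) (x [^] i \<otimes> y [^] (n - i))))"
      using x y by (intro finsum_rdistr) auto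
    also have "\<dots> = (\<Oplus>i\<in>{..n}. V i)"
      using x y UV by (intro finsum_cong') (auto simp: V_def add_pow_rdistr m_ac)
    finally show ?thesis .
  qed
  have yS: "y \<otimes> ?S = (\<Oplus>i\<in>{..n}. U i)"
  proof -
    have "y \<otimes> ?S = (\<Oplus>i\<in>{..n}. y \<otimes> (add_pow R (n choose i) (x [^] i \<otimes> y [^] (n - i))))"
      using x y by (intro finsum_rdistr) auto
    also have "\<dots> = (\<Oplus>i\<in>{..n}. U i)"
      using x y UV by (intro finsum_cong') (auto simp: U_def add_pow_rdistr m_ac Suc_diff_le)
    finally show ?thesis .
  qed
  \<comment> \<open>This vanishing term lets the sum of the \<open>U i\<close> run up to
    \<open>Suc n\<close>; splitting off its first term then aligns it with the \<open>V i\<close>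
    for Pascal's rule.\<close>
  have "U (Suc n) = \<zero>" by (simp add: U_def binomial_eq_0)
  hence "(\<Oplus>i\<in>{..n}. U i) = (\<Oplus>i\<in>{..Suc n}. U i)" using UV by (simp add: finsum_closed)
  also have "\<dots> = (\<Oplus>i\<in>{..n}. U (Suc i)) \<oplus> U 0" using UV by (intro finsum_Suc2) auto
  finally have U2: "(\<Oplus>i\<in>{..n}. U i) = (\<Oplus>i\<in>{..n}. U (Suc i)) \<oplus> U 0" .
  define W where "W i = add_pow R (Suc n choose i) (x [^] i \<otimes> y [^] (Suc n - i))" for i
  have W: "W i \<in> carrier R" for i using x y by (auto simp: W_def)
  have "(\<Oplus>i\<in>{..Suc n}. W i) = (\<Oplus>i\<in>{..n}. W (Suc i)) \<oplus> W 0" using W by (intro finsum_Suc2) auto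
  also have "(\<Oplus>i\<in>{..n}. W (Suc i)) = (\<Oplus>i\<in>{..n}. V i \<oplus> U (Suc i))"
  proof (rule finsum_cong')
    fix i
    have "x [^] Suc i \<otimes> y [^] (n - i) \<in> carrier R" using x y by simp
    thus "W (Suc i) = V i \<oplus> U (Suc i)"
      unfolding W_def V_def U_def by (simp only: binomial_Suc_Suc diff_Suc_Suc add.nat_pow_mult)
  qed (use UV in auto)
  also have "\<dots> = (\<Oplus>i\<in>{..n}. V i) \<oplus> (\<Oplus>i\<in>{..n}. U (Suc i))" using UV by (intro finsum_addf) auto
  also have "W 0 = U 0" by (simp add: W_def U_def)
  finally have "(\<Oplus>i\<in>{..Suc n}. W i) = x \<otimes> ?S \<oplus> y \<otimes> ?S"
    using UV xS yS U2 by (simp add: finsum_closed a_assoc)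
  also have "\<dots> = (x \<oplus> y) \<otimes> ?S" using x y S by (simp add: l_distr)
  also have "\<dots> = (x \<oplus> y) [^] Suc n" using Suc x y S by (simp add: m_comm)
  finally show ?case by (simp add: W_def)
qed

lemma (in cring) add_pow_zero_if_dvd:
  assumes "add_pow R (p) \<one> = \<zero>" "(p::nat) dvd k" "x \<in> carrier R"
  shows "add_pow R (k) x = \<zero>"
proof -
  obtain l where l: "k = p * l" using assms by blast
  have "add_pow R (p) x = add_pow R (p) \<one> \<otimes> x" using assms(3) by (simp add: add_pow_ldistr)
  hence "add_pow R (p) x = \<zero>" using assms by simp
  thus ?thesis using assms(3) l by (metis add.nat_pow_one add.nat_pow_pow)
qed

text \<open>All inner binomial coefficients are divisible by \<open>p\<close>, so only the two outer
  terms of the expansion survive.\<close>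

lemma (in cring) frobenius_add:
  assumes p: "Factorial_Ring.prime (p::nat)" and ch: "add_pow R (p) \<one> = \<zero>" and x: "x \<in> carrier R" and y: "y \<in> carrier R"
  shows "(x \<oplus> y) [^] p = x [^] p \<oplus> y [^] p"
proof -
  have p1: "1 < p" using p prime_gt_1_nat by blast
  then obtain r where r: "p = Suc r" by (cases p) auto
  define W where "W i = add_pow R (p choose i) (x [^] i \<otimes> y [^] (p - i))" for i
  have W: "W i \<in> carrier R" for i using x y by (auto simp: W_def)
  have W0: "W i = \<zero>" if "0 < i" "i < p" for i
    unfolding W_def using that p x y by (intro add_pow_zero_if_dvd[OF ch]) (auto intro!: dvd_choose_prime)
  have "(x \<oplus> y) [^] p = (\<Oplus>i\<in>{..Suc r}. W i)" using binomial_expansion[OF x y, of p] r by (simp add: W_def)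
  also have "\<dots> = W p \<oplus> (\<Oplus>i\<in>{..r}. W i)" using W r by (simp add: finsum_Suc)
  also have "(\<Oplus>i\<in>{..r}. W i) = W 0"
  proof -
    have "(\<Oplus>i\<in>{..r}. W i) = (\<Oplus>i\<in>{..r}. if i = 0 then W 0 else \<zero>)"
      using W W0 r by (intro finsum_cong') auto
    also have "\<dots> = (\<Oplus>i\<in>{..r}. if 0 = i then W i else \<zero>)" using W by (intro finsum_cong') auto
    also have "\<dots> = W 0" using W by (intro finsum_singleton) auto
    finally show ?thesis .
  qed
  finally show ?thesis using x y by (simp add: W_def)
qed

lemma (in cring) frobenius_power_add:
  assumes p: "Factorial_Ring.prime (p::nat)" and ch: "add_pow R (p) \<one> = \<zero>" and x: "x \<in> carrier R" and y: "y \<in> carrier R"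
  shows "(x \<oplus> y) [^] (p ^ k) = x [^] (p ^ k) \<oplus> y [^] (p ^ k)"
proof (induction k)
  case (Suc k)
  have e: "p ^ Suc k = p ^ k * p" by simp
  show ?case unfolding e using x y frobenius_add[OF p ch]
    by (simp add: Suc nat_pow_pow[symmetric])
qed (use x y in simp)

lemma ring_hom_char:
  assumes R: "ring R" "ring S" and h: "h \<in> ring_hom R S" and ch: "add_pow R (p::nat) \<one>\<^bsub>R\<^esub> = \<zero>\<^bsub>R\<^esub>"
  shows "add_pow S p \<one>\<^bsub>S\<^esub> = \<zero>\<^bsub>S\<^esub>"
proof -
  interpret ring_hom_ring R S h using R h by (rule ring_hom_ringI2)
  have "h (add_pow R (k::nat) \<one>\<^bsub>R\<^esub>) = add_pow S k \<one>\<^bsub>S\<^esub>" for k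
    by (induction k) (auto simp: R.add.nat_pow_Suc S.add.nat_pow_Suc)
  from this[of p] show ?thesis using ch by simp
qed


lemma ring_hom_nat_pow:
  assumes "ring R" "ring S" "h \<in> ring_hom R S" "x \<in> carrier R"
  shows "h (x [^]\<^bsub>R\<^esub> (k::nat)) = h x [^]\<^bsub>S\<^esub> k"
proof -
  interpret ring_hom_ring R S h using assms(1-3) by (rule ring_hom_ringI2)
  show ?thesis using assms(4) by (induction k) auto
qed

text \<open>If \<open>a\<close> is a root of \<open>P = X\<^sup>q - X\<close> and \<open>Y = X - a\<close>, then \<open>P = Y\<^sup>q - Y\<close> by the Frobenius
  identity, so \<open>Y\<^sup>2\<close> does not divide \<open>P\<close>.\<close>

lemma (in algebraically_closed) card_frobenius_fixed_points:
  fixes p k :: nat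
  assumes p: "Factorial_Ring.prime p" and k: "k \<ge> 1" and ch: "add_pow L p \<one> = \<zero>"
  defines "q \<equiv> p ^ k"
  shows "card {x \<in> carrier L. x [^] q = x} = q"
proof -
  let ?P = "poly_ring L"
  interpret UP: domain ?P by (rule univ_poly_is_domain[OF carrier_is_subring])
  have q2: "q \<ge> 2"
    using prime_ge_2_nat[OF p] k self_le_power[of p k] unfolding q_def by linarith
  have Xc: "X \<in> carrier ?P" using var_closed(1)[OF carrier_is_subring] .
  have emb: "poly_of_const \<in> ring_hom L ?P" using canonical_embedding_is_hom[OF carrier_is_subring] by simp
  have chP: "add_pow ?P p \<one>\<^bsub>?P\<^esub> = \<zero>\<^bsub>?P\<^esub>" by (rule ring_hom_char[OF ring_axioms UP.ring_axioms emb ch])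
  define f where "f = X [^]\<^bsub>?P\<^esub> q \<ominus>\<^bsub>?P\<^esub> X"
  have fc: "f \<in> carrier ?P" using Xc by (simp add: f_def)
  have "X [^]\<^bsub>?P\<^esub> q = monom \<one> q" using unitary_monom_eq_var_pow[OF carrier_is_subring] by simp
  hence lX: "length (X [^]\<^bsub>?P\<^esub> q) = Suc q" by (simp add: monom_def)
  have lX': "length (\<ominus>\<^bsub>?P\<^esub> X) = 2" using univ_poly_a_inv_length[OF carrier_is_subring Xc] by (simp add: var_def)
  have "f = poly_add (X [^]\<^bsub>?P\<^esub> q) (\<ominus>\<^bsub>?P\<^esub> X)" by (simp add: f_def a_minus_def univ_poly_add)
  moreover have "polynomial (carrier L) (X [^]\<^bsub>?P\<^esub> q)" "polynomial (carrier L) (\<ominus>\<^bsub>?P\<^esub> X)"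
    using Xc by (simp_all add: univ_poly_carrier)
  ultimately have df: "degree f = q"
    using poly_add_degree_eq[OF carrier_is_subring, of "X [^]\<^bsub>?P\<^esub> q" "\<ominus>\<^bsub>?P\<^esub> X"] lX lX' q2 by simp
  have fnz: "f \<noteq> []" using df q2 by auto
  have ev: "eval f a = a [^] q \<ominus> a" if a: "a \<in> carrier L" for a
  proof -
    interpret E: ring_hom_cring ?P L "\<lambda>g. eval g a" by (rule eval_cring_hom[OF carrier_is_subring a])
    have "eval (X [^]\<^bsub>?P\<^esub> q) a = a [^] q" using ring_hom_nat_pow[OF UP.ring_axioms ring_axioms E.homh Xc] eval_var[OF a] by simp
    moreover have "eval (\<ominus>\<^bsub>?P\<^esub> X) a = \<ominus> a" using E.hom_a_inv[OF Xc] eval_var[OF a] by simp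
    ultimately show ?thesis using Xc unfolding f_def a_minus_def by (subst E.hom_add) auto
  qed
  have set_roots: "set_mset (roots f) = {x \<in> carrier L. x [^] q = x}"
    using roots_mem_iff_is_root[OF fc] fnz ev by (auto simp: is_root_def)
  have simple: "count (roots f) a = 1" if a: "a \<in># roots f" for a
  proof (rule ccontr)
    assume "count (roots f) a \<noteq> 1"
    hence "alg_mult f a \<ge> 2" using a alg_mult_eq_count_roots[OF fc] by (metis One_nat_def Suc_1 Suc_leI count_greater_eq_one_iff le_neq_implies_less)
    have ac: "a \<in> carrier L" "a [^] q = a" using a set_roots by auto
    define Y where "Y = [\<one>, \<ominus> a]"
    define C where "C = poly_of_const a"
    have Yc: "Y \<in> carrier ?P" using ac by (auto simp: Y_def univ_poly_def polynomial_def)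
    have Cc: "C \<in> carrier ?P" using ring_hom_memE(1)[OF emb ac(1)] by (simp add: C_def)
    have XYC: "X = Y \<oplus>\<^bsub>?P\<^esub> C"
      using ac by (auto simp: Y_def C_def var_def univ_poly_add poly_of_const_def l_neg)
    have Cq: "C [^]\<^bsub>?P\<^esub> q = C"
      using ring_hom_nat_pow[OF ring_axioms UP.ring_axioms emb ac(1), of q] ac(2) by (simp add: C_def)
    have Xq: "X [^]\<^bsub>?P\<^esub> q = Y [^]\<^bsub>?P\<^esub> q \<oplus>\<^bsub>?P\<^esub> C"
      using UP.frobenius_power_add[OF p chP Yc Cc, of k] Cq XYC by (simp add: q_def)
    have f1: "f = Y [^]\<^bsub>?P\<^esub> q \<ominus>\<^bsub>?P\<^esub> Y"
      unfolding f_def Xq using Yc Cc by (subst XYC) (simp add: a_minus_def UP.minus_add UP.a_ac UP.r_neg1 UP.r_neg2)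
    \<comment> \<open>Writing the exponent as \<open>Suc (Suc r)\<close> leaves a factor
      \<open>Y\<close> in the first term even after one \<open>Y\<close> has been cancelled.\<close>
    define r where "r = q - 2"
    have r: "q = Suc (Suc r)" using q2 by (simp add: r_def)
    have "(Y [^]\<^bsub>?P\<^esub> (2::nat)) pdivides f"
      unfolding Y_def by (rule le_alg_mult_imp_pdivides[OF ac(1) fc \<open>alg_mult f a \<ge> 2\<close>])
    then obtain g where g: "g \<in> carrier ?P" "f = Y [^]\<^bsub>?P\<^esub> (2::nat) \<otimes>\<^bsub>?P\<^esub> g"
      unfolding pdivides_def factor_def by blast
    have Ynz: "Y \<noteq> \<zero>\<^bsub>?P\<^esub>" by (simp add: Y_def univ_poly_zero)
    have e1: "f = Y \<otimes>\<^bsub>?P\<^esub> (Y \<otimes>\<^bsub>?P\<^esub> g)" using g Yc by (simp add: numeral_2_eq_2 UP.m_assoc)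
    have e2: "f = Y \<otimes>\<^bsub>?P\<^esub> (Y \<otimes>\<^bsub>?P\<^esub> Y [^]\<^bsub>?P\<^esub> r \<ominus>\<^bsub>?P\<^esub> \<one>\<^bsub>?P\<^esub>)"
      using f1 Yc r by (simp add: a_minus_def UP.r_distr UP.r_minus UP.m_ac)
    have eq: "Y \<otimes>\<^bsub>?P\<^esub> g = Y \<otimes>\<^bsub>?P\<^esub> Y [^]\<^bsub>?P\<^esub> r \<ominus>\<^bsub>?P\<^esub> \<one>\<^bsub>?P\<^esub>"
      using UP.m_lcancel[OF Ynz Yc, of "Y \<otimes>\<^bsub>?P\<^esub> g" "Y \<otimes>\<^bsub>?P\<^esub> Y [^]\<^bsub>?P\<^esub> r \<ominus>\<^bsub>?P\<^esub> \<one>\<^bsub>?P\<^esub>"] e1 e2 g(1) Yc by simp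
    interpret E: ring_hom_cring ?P L "\<lambda>g. eval g a" by (rule eval_cring_hom[OF carrier_is_subring ac(1)])
    define u where "u = Y [^]\<^bsub>?P\<^esub> r"
    have uc: "u \<in> carrier ?P" unfolding u_def by (rule UP.nat_pow_closed[OF Yc])
    have ev0: "eval Y a = \<zero>" using ac by (simp add: Y_def r_neg)
    \<comment> \<open>Both sides of \<open>eq\<close> are evaluated at the root \<open>a\<close> of
      \<open>Y\<close>: one side gives zero, the other minus one.\<close>
    have "eval (Y \<otimes>\<^bsub>?P\<^esub> g) a = \<zero>"
      using E.hom_mult[OF Yc g(1)] E.hom_closed[OF g(1)] by (simp add: ev0)
    moreover have "eval (Y \<otimes>\<^bsub>?P\<^esub> u \<ominus>\<^bsub>?P\<^esub> \<one>\<^bsub>?P\<^esub>) a = \<ominus> \<one>"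
    proof -
      have "eval (Y \<otimes>\<^bsub>?P\<^esub> u \<oplus>\<^bsub>?P\<^esub> \<ominus>\<^bsub>?P\<^esub> \<one>\<^bsub>?P\<^esub>) a
          = eval (Y \<otimes>\<^bsub>?P\<^esub> u) a \<oplus> eval (\<ominus>\<^bsub>?P\<^esub> \<one>\<^bsub>?P\<^esub>) a"
        by (rule E.hom_add) (use Yc uc in simp_all)
      also have "eval (Y \<otimes>\<^bsub>?P\<^esub> u) a = \<zero>"
        using E.hom_mult[OF Yc uc] E.hom_closed[OF uc] by (simp add: ev0)
      also have "eval (\<ominus>\<^bsub>?P\<^esub> \<one>\<^bsub>?P\<^esub>) a = \<ominus> \<one>"
        using E.hom_a_inv[OF UP.one_closed] E.hom_one by simp
      finally show ?thesis by (simp add: a_minus_def)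
    qed
    ultimately have "\<ominus> \<one> = \<zero>" using eq by (simp only: u_def)
    hence "\<ominus> (\<ominus> \<one>) = \<zero>" by simp
    hence "\<one> = \<zero>" by (simp only: minus_minus[OF one_closed])
    thus False using one_not_zero by blast
  qed
  have "splitted f" using roots_over_carrier[OF fc] .
  hence "size (roots f) = q" using df by (simp add: splitted_def)
  moreover have "size (roots f) = card (set_mset (roots f))"
    using simple by (simp add: size_multiset_overloaded_eq)
  ultimately show ?thesis using set_roots by simp
qed

text \<open>The \<open>q\<close>-th power map respects sums by the Frobenius identity and products
  by commutativity, and fixed points of a field endomorphism form a subfield.\<close>

lemma (in algebraically_closed) frobenius_fixed_points_subfield:
  fixes p k :: nat
  assumes p: "Factorial_Ring.prime p" and ch: "add_pow L p \<one> = \<zero>"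
  defines "q \<equiv> p ^ k"
  shows "subfield {x \<in> carrier L. x [^] q = x} L"
proof (rule subfieldI')
  let ?F = "{x \<in> carrier L. x [^] q = x}"
  have q0: "q > 0" using prime_gt_0_nat[OF p] by (simp add: q_def)
  have fr: "(x \<oplus> y) [^] q = x [^] q \<oplus> y [^] q" if "x \<in> carrier L" "y \<in> carrier L" for x y
    unfolding q_def by (rule frobenius_power_add[OF p ch that])
  show "subring ?F L"
  proof (rule subringI)
    fix h assume h: "h \<in> ?F"
    \<comment> \<open>Expanding the power of \<open>h\<close> minus \<open>h\<close> avoids a case
      split on the sign of the \<open>q\<close>-th power of minus one, which depends on the parity
      of \<open>p\<close>.\<close>
    have "\<zero> = \<zero> [^] q" using q0 nat_pow_zero by simp
    also have "\<zero> [^] q = (h \<oplus> \<ominus> h) [^] q" using h by (simp add: r_neg)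
    also have "\<dots> = h \<oplus> (\<ominus> h) [^] q" using fr[of h "\<ominus> h"] h by simp
    finally have "h \<oplus> (\<ominus> h) [^] q = \<zero>" by simp
    hence "(\<ominus> h) [^] q = \<ominus> h" using h by (metis (no_types, lifting) a_comm a_inv_closed mem_Collect_eq minus_equality nat_pow_closed)
    thus "\<ominus> h \<in> ?F" using h by simp
  qed (auto simp: nat_pow_distrib fr)
  fix x assume x: "x \<in> ?F - {\<zero>}"
  hence xu: "x \<in> Units L" using field_Units by auto
  hence "(inv x) [^] q \<otimes> x = \<one>"
    using x nat_pow_distrib[of "inv x" x q] by (auto simp: Units_l_inv)
  hence "(inv x) [^] q = inv x"
    using xu x by (metis (no_types, lifting) DiffD1 Units_inv_closed inv_unique' mem_Collect_eq nat_pow_closed m_comm)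
  thus "inv x \<in> ?F" using xu by simp
qed

text \<open>The type is that of the algebraic closure of a ring over \<open>int\<close>, inside
  which the field is cut out as a set of fixed points.\<close>

lemma finite_field_exists:
  fixes p k :: nat
  assumes p: "Factorial_Ring.prime p" and k: "k \<ge> 1"
  shows "\<exists>F :: ((int list \<times> nat) multiset \<Rightarrow> int) ring.
    field F \<and> card (carrier F) = p ^ k \<and> (\<forall>x\<in>carrier F. add_pow F p x = \<zero>\<^bsub>F\<^esub>)"
proof -
  let ?R = "residue_ring (int p)"
  interpret R: residues_prime p ?R using p by unfold_locales
  define L where "L = R.alg_closure"
  interpret L: algebraic_closure L "R.indexed_const ` carrier ?R"
    unfolding L_def by (rule R.alg_closureE(1))
  have hom: "R.indexed_const \<in> ring_hom ?R L" unfolding L_def by (rule R.alg_closureE(2))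
  have "add_pow ?R p \<one>\<^bsub>?R\<^esub> = \<zero>\<^bsub>?R\<^esub>"
  proof -
    have "order (add_monoid ?R) = p" by (simp add: order_def residue_ring_def)
    thus ?thesis
      using group.pow_order_eq_1[OF R.add.group_axioms, of "\<one>\<^bsub>?R\<^esub>"] R.one_closed by (simp add: add_pow_def)
  qed
  hence ch: "add_pow L p \<one>\<^bsub>L\<^esub> = \<zero>\<^bsub>L\<^esub>" by (rule ring_hom_char[OF R.ring_axioms L.ring_axioms hom])
  define F where "F = {x \<in> carrier L. x [^]\<^bsub>L\<^esub> (p ^ k) = x}"
  have sf: "subfield F L" unfolding F_def by (rule L.frobenius_fixed_points_subfield[OF p ch])
  have "field (L\<lparr>carrier := F\<rparr>)" by (rule L.subfield_iff(2)[OF sf])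
  moreover have "card (carrier (L\<lparr>carrier := F\<rparr>)) = p ^ k"
    using L.card_frobenius_fixed_points[OF p k ch] by (simp add: F_def)
  moreover have "add_pow (L\<lparr>carrier := F\<rparr>) p x = \<zero>\<^bsub>L\<lparr>carrier := F\<rparr>\<^esub>" if "x \<in> F" for x
  proof -
    have "add_pow (L\<lparr>carrier := F\<rparr>) p x = add_pow L p x" by (simp add: add_pow_def nat_pow_def)
    thus ?thesis using L.add_pow_zero_if_dvd[OF ch dvd_refl, of x] that by (simp add: F_def)
  qed
  ultimately show ?thesis by (intro exI[of _ "L\<lparr>carrier := F\<rparr>"]) auto
qed

section \<open>Elementary abelian groups\<close>

lemma (in group) pow_mod_exponent:
  assumes "x \<in> carrier G" "x [^] (p::nat) = \<one>"
  shows "x [^] (k::nat) = x [^] (k mod p)"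
proof -
  have "x [^] k = x [^] (p * (k div p) + k mod p)" by simp
  also have "\<dots> = (x [^] p) [^] (k div p) \<otimes> x [^] (k mod p)"
    using assms(1) by (simp only: nat_pow_mult[symmetric] nat_pow_pow)
  finally show ?thesis using assms by simp
qed

text \<open>Another prime \<open>q\<close> dividing the order would yield, by Sylow, a subgroup of
  order \<open>q\<close>; the order of a nontrivial element of it would divide both \<open>q\<close>
  and \<open>p\<close>.\<close>

lemma (in group) order_prime_power_if_exponent:
  assumes fin: "finite (carrier G)" and p: "Factorial_Ring.prime (p::nat)"
    and ex: "\<And>x. x \<in> carrier G \<Longrightarrow> x [^] p = \<one>"
  shows "\<exists>k. order G = p ^ k"
proof -
  have "order G \<noteq> 0" using fin order_gt_0_iff_finite by simp
  then obtain k l where kl: "order G = p ^ k * l" "\<not> p dvd l"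
    using multiplicity_decompose'[of "order G" p] p by (metis not_prime_unit)
  have "l = 1"
  proof (rule ccontr)
    assume "l \<noteq> 1"
    then obtain q where q: "Factorial_Ring.prime q" "q dvd l" by (metis prime_factor_nat)
    have "order G = q ^ 1 * (p ^ k * (l div q))" using kl(1) q(2) by auto
    then obtain H where H: "subgroup H G" "card H = q ^ 1"
      using sylow_thm[OF q(1) group_axioms _ fin] by blast
    have "card H \<noteq> 1" "card H \<noteq> 0" using H(2) q(1) by auto
    hence "\<not> H \<subseteq> {\<one>}"
      by (metis card.empty card.insert empty_iff finite.intros(1) subset_singletonD One_nat_def)
    then obtain x where x: "x \<in> H" "x \<noteq> \<one>" by blast
    have xG: "x \<in> carrier G" using subgroup.mem_carrier[OF H(1) x(1)] .
    have "coprime q p" using q kl(2) p primes_coprime by blast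
    have "x [^] q = \<one>"
    proof -
      interpret H: group "G\<lparr>carrier := H\<rparr>" by (rule subgroup.subgroup_is_group[OF H(1) group_axioms])
      have "x [^]\<^bsub>G\<lparr>carrier := H\<rparr>\<^esub> order (G\<lparr>carrier := H\<rparr>) = \<one>\<^bsub>G\<lparr>carrier := H\<rparr>\<^esub>"
        using x by (intro H.pow_order_eq_1) simp
      thus ?thesis using H(2) by (simp add: order_def nat_pow_consistent[symmetric])
    qed
    moreover have "x [^] p = \<one>" using ex xG .
    ultimately have "ord x dvd q" "ord x dvd p" using pow_eq_id[OF xG] by auto
    hence "ord x = 1" using \<open>coprime q p\<close> by (metis coprime_common_divisor_nat)
    thus False using ord_eq_1[OF xG] x by simp
  qed
  thus ?thesis using kl by auto
qed

text \<open>A maximal subgroup of the direct product that is the graph of a partial isomorphism must be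
  the graph of an isomorphism.\<close>

lemma elementary_abelian_iso:
  fixes p :: nat
  assumes G: "comm_group G" "finite (carrier G)" and H: "comm_group H" "finite (carrier H)"
    and card: "card (carrier G) = card (carrier H)" and p: "Factorial_Ring.prime p"
    and exG: "\<And>x. x \<in> carrier G \<Longrightarrow> x [^]\<^bsub>G\<^esub> p = \<one>\<^bsub>G\<^esub>"
    and exH: "\<And>x. x \<in> carrier H \<Longrightarrow> x [^]\<^bsub>H\<^esub> p = \<one>\<^bsub>H\<^esub>"
  shows "\<exists>\<psi>. \<psi> \<in> iso G H"
proof -
  interpret G: comm_group G by fact
  interpret H: comm_group H by fact
  \<comment> \<open>The last clause makes a subgroup the graph of an injective partial homomorphism.
    Closure under inverses follows from closure under products, an inverse being the power with
    exponent \<open>p - 1\<close>.\<close>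
  define ok where "ok S \<longleftrightarrow> S \<subseteq> carrier G \<times> carrier H \<and> (\<one>\<^bsub>G\<^esub>, \<one>\<^bsub>H\<^esub>) \<in> S \<and>
     (\<forall>x y x' y'. (x, y) \<in> S \<longrightarrow> (x', y') \<in> S \<longrightarrow> (x \<otimes>\<^bsub>G\<^esub> x', y \<otimes>\<^bsub>H\<^esub> y') \<in> S) \<and>
     (\<forall>x y. (x, y) \<in> S \<longrightarrow> (x = \<one>\<^bsub>G\<^esub> \<longleftrightarrow> y = \<one>\<^bsub>H\<^esub>))" for S
  have "finite {S. ok S}"
    by (rule finite_subset[of _ "Pow (carrier G \<times> carrier H)"]) (use G H in \<open>auto simp: ok_def\<close>)
  moreover have "ok {(\<one>\<^bsub>G\<^esub>, \<one>\<^bsub>H\<^esub>)}" by (simp add: ok_def)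
  ultimately obtain S where S: "ok S" and max: "\<And>T. ok T \<Longrightarrow> S \<subseteq> T \<Longrightarrow> T = S"
    using finite_has_maximal[of "{S. ok S}"] by blast
  have sub: "S \<subseteq> carrier G \<times> carrier H" and one: "(\<one>\<^bsub>G\<^esub>, \<one>\<^bsub>H\<^esub>) \<in> S"
    and mult: "\<And>x y x' y'. (x, y) \<in> S \<Longrightarrow> (x', y') \<in> S \<Longrightarrow> (x \<otimes>\<^bsub>G\<^esub> x', y \<otimes>\<^bsub>H\<^esub> y') \<in> S"
    and iff: "\<And>x y. (x, y) \<in> S \<Longrightarrow> x = \<one>\<^bsub>G\<^esub> \<longleftrightarrow> y = \<one>\<^bsub>H\<^esub>"
    using S unfolding ok_def by blast+
  have car: "x \<in> carrier G" "y \<in> carrier H" if "(x, y) \<in> S" for x y using sub that by auto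
  have pow: "(x [^]\<^bsub>G\<^esub> (k::nat), y [^]\<^bsub>H\<^esub> k) \<in> S" if "(x, y) \<in> S" for x y k
    by (induction k) (auto simp: one mult that)
  have p1: "p = Suc (p - 1)" using prime_gt_0_nat[OF p] by simp
  have invG: "x [^]\<^bsub>G\<^esub> (p - 1) = inv\<^bsub>G\<^esub> x" if "x \<in> carrier G" for x
  proof -
    have "x [^]\<^bsub>G\<^esub> (p - 1) \<otimes>\<^bsub>G\<^esub> x = \<one>\<^bsub>G\<^esub>" using exG[OF that] p1 by (metis G.nat_pow_Suc)
    thus ?thesis using that by (simp add: G.inv_equality)
  qed
  have invH: "x [^]\<^bsub>H\<^esub> (p - 1) = inv\<^bsub>H\<^esub> x" if "x \<in> carrier H" for x
  proof -
    have "x [^]\<^bsub>H\<^esub> (p - 1) \<otimes>\<^bsub>H\<^esub> x = \<one>\<^bsub>H\<^esub>" using exH[OF that] p1 by (metis H.nat_pow_Suc)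
    thus ?thesis using that by (simp add: H.inv_equality)
  qed
  have inv: "(inv\<^bsub>G\<^esub> x, inv\<^bsub>H\<^esub> y) \<in> S" if "(x, y) \<in> S" for x y
    using pow[OF that, of "p - 1"] invG invH car[OF that] by simp
  have inj: "x = x' \<longleftrightarrow> y = y'" if a: "(x, y) \<in> S" "(x', y') \<in> S" for x y x' y'
  proof -
    have "x \<otimes>\<^bsub>G\<^esub> inv\<^bsub>G\<^esub> x' = \<one>\<^bsub>G\<^esub> \<longleftrightarrow> y \<otimes>\<^bsub>H\<^esub> inv\<^bsub>H\<^esub> y' = \<one>\<^bsub>H\<^esub>"
      using iff[OF mult[OF a(1) inv[OF a(2)]]] .
    moreover have "x \<otimes>\<^bsub>G\<^esub> inv\<^bsub>G\<^esub> x' = \<one>\<^bsub>G\<^esub> \<longleftrightarrow> x = x'"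
      using car[OF a(1)] car[OF a(2)] by (metis G.inv_closed G.inv_equality G.inv_inv G.r_inv)
    moreover have "y \<otimes>\<^bsub>H\<^esub> inv\<^bsub>H\<^esub> y' = \<one>\<^bsub>H\<^esub> \<longleftrightarrow> y = y'"
      using car[OF a(1)] car[OF a(2)] by (metis H.inv_closed H.inv_equality H.inv_inv H.r_inv)
    ultimately show ?thesis by simp
  qed
  have finS: "finite S" using finite_subset[OF sub] G H by simp
  have c1: "card (fst ` S) = card S" and c2: "card (snd ` S) = card S"
    by (rule card_image, rule inj_onI, use inj in force)+
  have total: "fst ` S = carrier G"
  proof (rule ccontr)
    assume ne: "fst ` S \<noteq> carrier G"
    have "fst ` S \<subset> carrier G" using ne car by auto
    hence lt: "card S < card (carrier G)" using c1 psubset_card_mono[OF G(2)] by metis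
    obtain g where g: "g \<in> carrier G" "g \<notin> fst ` S" using \<open>fst ` S \<subset> carrier G\<close> by blast
    have "snd ` S \<noteq> carrier H" using lt c2 card by auto
    moreover have "snd ` S \<subseteq> carrier H" using car by auto
    ultimately obtain h where h: "h \<in> carrier H" "h \<notin> snd ` S" by blast
    \<comment> \<open>For \<open>k\<close> prime to \<open>p\<close>, the element \<open>g\<close>
      is a power of its own \<open>k\<close>-th power and would lie in the domain of
      \<open>S\<close>.\<close>
    have dvdG: "p dvd k" if k: "g [^]\<^bsub>G\<^esub> k \<in> fst ` S" for k
    proof (rule ccontr)
      assume "\<not> p dvd k"
      hence "coprime k p" using p by (metis coprime_commute prime_imp_coprime)
      then obtain u where "[k * u = Suc 0] (mod p)" using cong_solve_coprime_nat by blast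
      hence "k * u mod p = 1 mod p" by (simp add: cong_def)
      hence "g [^]\<^bsub>G\<^esub> (k * u) = g"
        using G.pow_mod_exponent[OF g(1) exG[OF g(1)], of "k * u"] G.pow_mod_exponent[OF g(1) exG[OF g(1)], of 1] g(1) by simp
      moreover have "(g [^]\<^bsub>G\<^esub> k) [^]\<^bsub>G\<^esub> u \<in> fst ` S" using k pow by force
      ultimately show False using g by (simp add: G.nat_pow_pow)
    qed
    have dvdH: "p dvd k" if k: "h [^]\<^bsub>H\<^esub> k \<in> snd ` S" for k
    proof (rule ccontr)
      assume "\<not> p dvd k"
      hence "coprime k p" using p by (metis coprime_commute prime_imp_coprime)
      then obtain u where "[k * u = Suc 0] (mod p)" using cong_solve_coprime_nat by blast
      hence "k * u mod p = 1 mod p" by (simp add: cong_def)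
      hence "h [^]\<^bsub>H\<^esub> (k * u) = h"
        using H.pow_mod_exponent[OF h(1) exH[OF h(1)], of "k * u"] H.pow_mod_exponent[OF h(1) exH[OF h(1)], of 1] h(1) by simp
      moreover have "(h [^]\<^bsub>H\<^esub> k) [^]\<^bsub>H\<^esub> u \<in> snd ` S" using k pow by force
      ultimately show False using h by (simp add: H.nat_pow_pow)
    qed
    have pwG: "g [^]\<^bsub>G\<^esub> k = \<one>\<^bsub>G\<^esub>" and pwH: "h [^]\<^bsub>H\<^esub> k = \<one>\<^bsub>H\<^esub>" if "p dvd k" for k
      using G.pow_mod_exponent[OF g(1) exG[OF g(1)], of k] H.pow_mod_exponent[OF h(1) exH[OF h(1)], of k] that by simp_all
    \<comment> \<open>The pair \<open>(g, h)\<close> can be adjoined: a power of \<open>g\<close>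
      lies in the domain of \<open>S\<close>, or a power of \<open>h\<close> in its range, only if
      \<open>p\<close> divides the exponent, and then both powers are trivial.\<close>
    define T where "T = {(x \<otimes>\<^bsub>G\<^esub> g [^]\<^bsub>G\<^esub> k, y \<otimes>\<^bsub>H\<^esub> h [^]\<^bsub>H\<^esub> k) | x y (k::nat). (x, y) \<in> S}"
    have ST: "S \<subseteq> T"
    proof clarify
      fix x y assume xy: "(x, y) \<in> S"
      hence "(x \<otimes>\<^bsub>G\<^esub> g [^]\<^bsub>G\<^esub> (0::nat), y \<otimes>\<^bsub>H\<^esub> h [^]\<^bsub>H\<^esub> (0::nat)) \<in> T" unfolding T_def by blast
      thus "(x, y) \<in> T" using car[OF xy] by simp
    qed
    have "(\<one>\<^bsub>G\<^esub> \<otimes>\<^bsub>G\<^esub> g [^]\<^bsub>G\<^esub> (1::nat), \<one>\<^bsub>H\<^esub> \<otimes>\<^bsub>H\<^esub> h [^]\<^bsub>H\<^esub> (1::nat)) \<in> T" unfolding T_def using one by blast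
    hence gT: "(g, h) \<in> T" using g h by simp
    have "ok T"
      unfolding ok_def
    proof (intro conjI allI impI)
      show "T \<subseteq> carrier G \<times> carrier H" using car g h by (auto simp: T_def)
      show "(\<one>\<^bsub>G\<^esub>, \<one>\<^bsub>H\<^esub>) \<in> T" using ST one by blast
      fix x y x' y' assume "(x, y) \<in> T" "(x', y') \<in> T"
      then obtain a b a' b' and k k' :: nat where
        1: "x = a \<otimes>\<^bsub>G\<^esub> g [^]\<^bsub>G\<^esub> k" "y = b \<otimes>\<^bsub>H\<^esub> h [^]\<^bsub>H\<^esub> k" "(a, b) \<in> S"
          "x' = a' \<otimes>\<^bsub>G\<^esub> g [^]\<^bsub>G\<^esub> k'" "y' = b' \<otimes>\<^bsub>H\<^esub> h [^]\<^bsub>H\<^esub> k'" "(a', b') \<in> S"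
        unfolding T_def by blast
      have "x \<otimes>\<^bsub>G\<^esub> x' = (a \<otimes>\<^bsub>G\<^esub> a') \<otimes>\<^bsub>G\<^esub> g [^]\<^bsub>G\<^esub> (k + k')"
        using 1 car[OF 1(3)] car[OF 1(6)] g by (simp add: G.nat_pow_mult[symmetric] G.m_ac)
      moreover have "y \<otimes>\<^bsub>H\<^esub> y' = (b \<otimes>\<^bsub>H\<^esub> b') \<otimes>\<^bsub>H\<^esub> h [^]\<^bsub>H\<^esub> (k + k')"
        using 1 car[OF 1(3)] car[OF 1(6)] h by (simp add: H.nat_pow_mult[symmetric] H.m_ac)
      ultimately show "(x \<otimes>\<^bsub>G\<^esub> x', y \<otimes>\<^bsub>H\<^esub> y') \<in> T" unfolding T_def using mult[OF 1(3) 1(6)] by blast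
    next
      fix x y assume "(x, y) \<in> T"
      then obtain a b and k :: nat where
        1: "x = a \<otimes>\<^bsub>G\<^esub> g [^]\<^bsub>G\<^esub> k" "y = b \<otimes>\<^bsub>H\<^esub> h [^]\<^bsub>H\<^esub> k" and ab: "(a, b) \<in> S"
        unfolding T_def by blast
      note cab = car[OF ab]
      show "x = \<one>\<^bsub>G\<^esub> \<longleftrightarrow> y = \<one>\<^bsub>H\<^esub>"
      proof
        assume "x = \<one>\<^bsub>G\<^esub>"
        hence "inv\<^bsub>G\<^esub> a = g [^]\<^bsub>G\<^esub> k" using 1(1) cab g by (metis G.inv_equality G.m_comm G.nat_pow_closed)
        hence "p dvd k" using dvdG inv[OF ab] by (metis fst_conv image_eqI)
        thus "y = \<one>\<^bsub>H\<^esub>" using 1 \<open>x = \<one>\<^bsub>G\<^esub>\<close> pwG pwH cab iff[OF ab] by simp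
      next
        assume "y = \<one>\<^bsub>H\<^esub>"
        hence "inv\<^bsub>H\<^esub> b = h [^]\<^bsub>H\<^esub> k" using 1(2) cab h by (metis H.inv_equality H.m_comm H.nat_pow_closed)
        hence "p dvd k" using dvdH inv[OF ab] by (metis snd_conv image_eqI)
        thus "x = \<one>\<^bsub>G\<^esub>" using 1 \<open>y = \<one>\<^bsub>H\<^esub>\<close> pwG pwH cab iff[OF ab] by simp
      qed
    qed
    hence "T = S" using max ST by blast
    thus False using gT g by force
  qed
  have total': "snd ` S = carrier H"
    using c1 c2 total card H(2) car by (intro card_subset_eq) auto
  define \<psi> where "\<psi> x = (THE y. (x, y) \<in> S)" for x
  have psi: "\<psi> x = y" if "(x, y) \<in> S" for x y
    unfolding \<psi>_def 
  proof (rule the_equality[where P = "\<lambda>y. (x, y) \<in> S", OF that])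
    fix y' assume "(x, y') \<in> S"
    from inj[OF this that] show "y' = y" by simp
  qed
  have psiS: "(x, \<psi> x) \<in> S" if x: "x \<in> carrier G" for x
  proof -
    have "x \<in> fst ` S" using x total by simp
    then obtain y where y: "(x, y) \<in> S" by auto
    thus ?thesis using psi[OF y] by simp
  qed
  have "\<psi> \<in> hom G H"
  proof (rule homI)
    show "\<psi> x \<in> carrier H" if "x \<in> carrier G" for x using car(2)[OF psiS[OF that]] .
    show "\<psi> (x \<otimes>\<^bsub>G\<^esub> y) = \<psi> x \<otimes>\<^bsub>H\<^esub> \<psi> y" if "x \<in> carrier G" "y \<in> carrier G" for x y
      using psi[OF mult[OF psiS[OF that(1)] psiS[OF that(2)]]] .
  qed
  moreover have "bij_betw \<psi> (carrier G) (carrier H)"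
    unfolding bij_betw_def
  proof
    show "inj_on \<psi> (carrier G)"
    proof (rule inj_onI)
      fix x y assume xy: "x \<in> carrier G" "y \<in> carrier G" "\<psi> x = \<psi> y"
      show "x = y" using inj[OF psiS[OF xy(1)] psiS[OF xy(2)]] xy(3) by simp
    qed
    show "\<psi> ` carrier G = carrier H"
    proof
      show "\<psi> ` carrier G \<subseteq> carrier H" using car(2)[OF psiS] by auto
      show "carrier H \<subseteq> \<psi> ` carrier G"
      proof
        fix y assume "y \<in> carrier H"
        hence "y \<in> snd ` S" using total' by simp
        then obtain x where x: "(x, y) \<in> S" by auto
        show "y \<in> \<psi> ` carrier G" using psi[OF x] car(1)[OF x] by (metis imageI)
      qed
    qed
  qed
  ultimately show ?thesis by (auto simp: iso_def)
qed

section \<open>Vector-functions and cores\<close>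

lemma length_vapply [simp]: "length (vapply \<Psi> xs) = length xs"
  by (simp add: vapply_def)

lemma nth_vapply [simp]: "i < length xs \<Longrightarrow> vapply \<Psi> xs ! i = \<Psi> i (xs ! i)"
  by (simp add: vapply_def)

lemma vapply_vapply: "vapply \<Psi> (vapply \<Phi> xs) = vapply (\<lambda>i. \<Psi> i \<circ> \<Phi> i) xs"
  by (rule nth_equalityI) auto

lemma vapply_list_update:
  "i < length xs \<Longrightarrow> vapply \<Psi> (xs[i := c]) = (vapply \<Psi> xs)[i := \<Psi> i c]"
  by (rule nth_equalityI) (auto simp: nth_list_update)

lemma vapply_ident: "(\<And>i. i < length xs \<Longrightarrow> \<Psi> i (xs ! i) = xs ! i) \<Longrightarrow> vapply \<Psi> xs = xs"
  by (rule nth_equalityI) auto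

lemma mem_tuples_iff: "xs \<in> tuples A n \<longleftrightarrow> length xs = n \<and> (\<forall>i<n. xs ! i \<in> A)"
  by (auto simp: tuples_def set_conv_nth)

lemma mem_prod_set_iff: "xs \<in> prod_set n B \<longleftrightarrow> length xs = n \<and> (\<forall>i<n. xs ! i \<in> B i)"
  by (simp add: prod_set_def)

lemma prod_set_update: "xs \<in> prod_set n B \<Longrightarrow> (i < n \<Longrightarrow> c \<in> B i) \<Longrightarrow> xs[i := c] \<in> prod_set n B"
  by (cases "i < length xs") (auto simp: mem_prod_set_iff nth_list_update)

lemma finite_tuples: "finite A \<Longrightarrow> finite (tuples A n)"
  unfolding tuples_def using finite_lists_length_eq[of A n] by (simp add: conj_commute)

lemma vapply_tuples: "uvf A n \<Psi> \<Longrightarrow> xs \<in> tuples A n \<Longrightarrow> vapply \<Psi> xs \<in> tuples A n"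
  by (auto simp: mem_tuples_iff uvf_def)

lemma vapply_pow: "vapply (\<lambda>i. \<Psi> i ^^ k) xs = (vapply \<Psi> ^^ k) xs"
proof (induction k)
  case 0 show ?case by (simp add: vapply_ident)
next
  case (Suc k)
  have "vapply (\<lambda>i. \<Psi> i ^^ Suc k) xs = vapply \<Psi> (vapply (\<lambda>i. \<Psi> i ^^ k) xs)"
    unfolding vapply_vapply by (simp add: comp_def)
  thus ?case by (simp only: Suc funpow.simps comp_def)
qed

lemma uvf_pow: "uvf A n \<Psi> \<Longrightarrow> i < n \<Longrightarrow> x \<in> A \<Longrightarrow> (\<Psi> i ^^ k) x \<in> A"
  by (induction k) (auto simp: uvf_def)

lemma preserves_pow: "preserves \<Psi> \<rho> \<Longrightarrow> preserves (\<lambda>i. \<Psi> i ^^ k) \<rho>"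
  unfolding preserves_def vapply_pow by (induction k) auto

text \<open>The powers are compared on all coordinates at once, so the pigeonhole principle yields a
  single exponent for every coordinate.\<close>

lemma uvf_idempotent_power:
  assumes "finite A" and uvf: "uvf A n \<Psi>"
  obtains k where "k \<ge> 1" "\<And>i x. i < n \<Longrightarrow> x \<in> A \<Longrightarrow> (\<Psi> i ^^ k) ((\<Psi> i ^^ k) x) = (\<Psi> i ^^ k) x"
proof -
  define h where "h k = (\<lambda>q\<in>{..<n} \<times> A. (\<Psi> (fst q) ^^ k) (snd q))" for k
  have fin: "finite (({..<n} \<times> A) \<rightarrow>\<^sub>E A)" using assms by (intro finite_PiE) auto
  have "range h \<subseteq> (({..<n} \<times> A) \<rightarrow>\<^sub>E A)" using uvf_pow[OF uvf] by (auto simp: h_def PiE_def extensional_def)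
  hence "finite (range h)" using fin finite_subset by blast
  hence "\<not> inj h" using finite_imageD infinite_UNIV_nat by blast
  then obtain a b where "a < b" "h a = h b" by (metis injI linorder_neqE_nat)
  define d where "d = b - a"
  have d: "d \<ge> 1" "b = a + d" using \<open>a < b\<close> by (auto simp: d_def)
  have per0: "(\<Psi> i ^^ a) x = (\<Psi> i ^^ (a + d)) x" if "i < n" "x \<in> A" for i x
    using fun_cong[OF \<open>h a = h b\<close>, of "(i, x)"] that d by (simp add: h_def)
  have per: "(\<Psi> i ^^ (a + r + d)) x = (\<Psi> i ^^ (a + r)) x" if "i < n" "x \<in> A" for i x r
  proof -
    have "a + r + d = r + (a + d)" "a + r = r + a" by simp_all
    thus ?thesis using per0[OF that] by (simp only: funpow_add o_apply)
  qed
  have per2: "(\<Psi> i ^^ (a + r + d * t)) x = (\<Psi> i ^^ (a + r)) x" if "i < n" "x \<in> A" for i x r t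
  proof (induction t)
    case (Suc t)
    have "a + r + d * Suc t = a + (r + d * t) + d" by simp
    then show ?case using per[OF that, of "r + d * t"] Suc by (simp add: ac_simps)
  qed simp
  \<comment> \<open>A multiple of the period \<open>d\<close> that is at least the preperiod
    \<open>a\<close>.\<close>
  define k where "k = d * (a + 1)"
  have "k \<ge> a" "k \<ge> 1" using d(1) mult_le_mono1[of 1 d "a+1"] by (auto simp: k_def)
  have "(\<Psi> i ^^ k) ((\<Psi> i ^^ k) x) = (\<Psi> i ^^ k) x" if "i < n" "x \<in> A" for i x
  proof -
    have "(\<Psi> i ^^ (k + k)) x = (\<Psi> i ^^ k) x"
      using per2[OF that, of "k - a" "a + 1"] \<open>k \<ge> a\<close> unfolding k_def[symmetric] by simp
    thus ?thesis by (simp add: funpow_add)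
  qed
  thus ?thesis using that \<open>k \<ge> 1\<close> by blast
qed

text \<open>The conjunction to test is that of all projections of \<rho> that forget one coordinate.
  Essentiality yields a tuple outside \<rho> that satisfies all of them.\<close>

lemma essential_obtains:
  assumes "essential A n \<rho>" "n \<ge> 1"
  obtains \<gamma> where "\<gamma> \<in> tuples A n - \<rho>" "\<And>i. i < n \<Longrightarrow> \<exists>c\<in>A. \<gamma>[i := c] \<in> \<rho>"
proof -
  define js where "js i = [0..<i] @ [Suc i..<n]" for i
  define C where "C = (\<lambda>i. (js i, (\<lambda>xs. map (\<lambda>j. xs ! j) (js i)) ` \<rho>)) ` {..<n}"
  have sub: "\<rho> \<subseteq> tuples A n" and nc: "\<not> is_smaller_conj A n \<rho>" using assms(1) by (auto simp: essential_def)
  have len: "length (js i) < n" "set (js i) = {..<n} - {i}" if "i < n" for i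
    using that by (auto simp: js_def)
  have "\<forall>(is, \<tau>)\<in>C. length is < n \<and> set is \<subseteq> {..<n} \<and> \<tau> \<subseteq> tuples A (length is)"
  proof -
    have "map ((!) xs) (js i) \<in> tuples A (length (js i))" if "i < n" "xs \<in> \<rho>" for i xs
      using sub that len(2)[OF that(1)] by (auto simp: mem_tuples_iff set_conv_nth[of "js i"] subset_iff)
    thus ?thesis unfolding C_def using len by auto
  qed
  hence "\<rho> \<noteq> {xs\<in>tuples A n. \<forall>(is, \<tau>)\<in>C. map (\<lambda>j. xs ! j) is \<in> \<tau>}"
    using nc unfolding is_smaller_conj_def by blast
  moreover have "\<rho> \<subseteq> {xs\<in>tuples A n. \<forall>(is, \<tau>)\<in>C. map (\<lambda>j. xs ! j) is \<in> \<tau>}"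
    using sub by (auto simp: C_def)
  ultimately obtain \<gamma> where g: "\<gamma> \<in> tuples A n" "\<gamma> \<notin> \<rho>" "\<forall>(is, \<tau>)\<in>C. map (\<lambda>j. \<gamma> ! j) is \<in> \<tau>"
    by blast
  have "\<exists>c\<in>A. \<gamma>[i := c] \<in> \<rho>" if i: "i < n" for i
  proof -
    have "map (\<lambda>j. \<gamma> ! j) (js i) \<in> (\<lambda>xs. map (\<lambda>j. xs ! j) (js i)) ` \<rho>"
      using g(3) i by (auto simp: C_def)
    then obtain xs where xs: "xs \<in> \<rho>" "map (\<lambda>j. \<gamma> ! j) (js i) = map (\<lambda>j. xs ! j) (js i)" by blast
    have "xs \<in> tuples A n" using xs sub by blast
    have eq: "\<gamma> ! j = xs ! j" if "j < n" "j \<noteq> i" for j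
      using xs(2) that len(2)[OF i] unfolding map_eq_conv by blast
    have "\<gamma>[i := xs ! i] = xs"
    proof (rule nth_equalityI)
      fix j assume "j < length (\<gamma>[i := xs ! i])"
      thus "\<gamma>[i := xs ! i] ! j = xs ! j"
        using eq[of j] g(1) by (cases "j = i") (auto simp: mem_tuples_iff)
    qed (use g(1) \<open>xs \<in> tuples A n\<close> in \<open>auto simp: mem_tuples_iff\<close>)
    thus ?thesis using xs \<open>xs \<in> tuples A n\<close> i by (metis mem_tuples_iff)
  qed
  thus ?thesis using that g by blast
qed

lemma uvf_comp: "uvf A n \<Psi> \<Longrightarrow> uvf A n \<Phi> \<Longrightarrow> uvf A n (\<lambda>i. \<Psi> i \<circ> \<Phi> i)"
  by (simp add: uvf_def)

lemma preserves_comp: "preserves \<Psi> \<rho> \<Longrightarrow> preserves \<Phi> \<rho> \<Longrightarrow> preserves (\<lambda>i. \<Psi> i \<circ> \<Phi> i) \<rho>"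
  by (simp add: preserves_def flip: vapply_vapply)

text \<open>The properties of a core on which everything later rests. \<open>B i\<close> stands for
  the image of the core map in coordinate \<open>i\<close>; the last assumption is the injective
  side of the dichotomy.\<close>

locale core_relation =
  fixes A :: "'a set" and n :: nat and \<sigma> :: "'a list set" and B :: "nat \<Rightarrow> 'a set"
  assumes fin: "finite A"
    and B_sub: "\<And>i. i < n \<Longrightarrow> B i \<subseteq> A"
    and sig_sub: "\<sigma> \<subseteq> prod_set n B"
    and proj: "\<And>i b. i < n \<Longrightarrow> b \<in> B i \<Longrightarrow> \<exists>x\<in>\<sigma>. x ! i = b"
    and key_sub: "\<And>\<beta>. key_tuple A n \<sigma> \<beta> \<Longrightarrow> \<beta> \<in> prod_set n B"
    and key_line: "\<And>\<beta> i. key_tuple A n \<sigma> \<beta> \<Longrightarrow> i < n \<Longrightarrow> \<exists>c. \<beta>[i := c] \<in> \<sigma>"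
    and inj_on_if_not_kill: "\<And>\<beta> \<Theta> i. key_tuple A n \<sigma> \<beta> \<Longrightarrow> uvf A n \<Theta> \<Longrightarrow> preserves \<Theta> \<sigma> \<Longrightarrow>
       vapply \<Theta> \<beta> \<notin> \<sigma> \<Longrightarrow> i < n \<Longrightarrow> inj_on (\<Theta> i) (B i)"

lemma core_relation_if_is_core:
  assumes fin: "finite A" and n: "n \<ge> 2"
    and ess: "essential A n \<rho>" and core: "is_core A n \<rho> \<sigma>"
  shows "\<exists>B. core_relation A n \<sigma> B"
proof -
  have rho_sub: "\<rho> \<subseteq> tuples A n" using ess by (simp add: essential_def)
  from core obtain \<Psi> where cf: "core_fun A n \<rho> \<Psi>" and img: "vapply \<Psi> ` \<rho> = \<sigma>"
    and min: "\<And>\<Psi>'. core_fun A n \<rho> \<Psi>' \<Longrightarrow> \<not> vapply \<Psi>' ` tuples A n \<subset> vapply \<Psi> ` tuples A n"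
    and sr: "\<sigma> \<subseteq> \<rho>"
    unfolding is_core_def by blast
  have uvf: "uvf A n \<Psi>" and pres: "preserves \<Psi> \<rho>"
    and idem: "\<And>i x. i < n \<Longrightarrow> x \<in> A \<Longrightarrow> \<Psi> i (\<Psi> i x) = \<Psi> i x"
    using cf by (auto simp: core_fun_def)
  obtain \<alpha> where ka: "key_tuple A n \<rho> \<alpha>" and fixa: "vapply \<Psi> \<alpha> = \<alpha>" using cf by (auto simp: core_fun_def)
  have a_tup: "\<alpha> \<in> tuples A n" and a_notin: "\<alpha> \<notin> \<rho>" using ka by (auto simp: key_tuple_def)
  define B where "B i = \<Psi> i ` A" for i
  have B_sub: "B i \<subseteq> A" if "i < n" for i using uvf that by (auto simp: B_def uvf_def)
  have B_fix: "\<Psi> i b = b" if "i < n" "b \<in> B i" for i b using idem that by (auto simp: B_def)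
  have PB_tup: "x \<in> tuples A n" if "x \<in> prod_set n B" for x
    using that B_sub by (auto simp: mem_tuples_iff mem_prod_set_iff)
  have PB_fix: "vapply \<Psi> x = x" if "x \<in> prod_set n B" for x
    using that B_fix by (intro vapply_ident) (auto simp: mem_prod_set_iff)
  have im: "vapply \<Psi> ` tuples A n = prod_set n B"
  proof
    show "vapply \<Psi> ` tuples A n \<subseteq> prod_set n B" by (auto simp: mem_tuples_iff mem_prod_set_iff B_def)
    show "prod_set n B \<subseteq> vapply \<Psi> ` tuples A n"
      using PB_fix PB_tup by (metis imageI subsetI)
  qed
  have sig_eq: "\<sigma> = \<rho> \<inter> prod_set n B"
  proof
    show "\<sigma> \<subseteq> \<rho> \<inter> prod_set n B" using sr img im rho_sub by blast
    show "\<rho> \<inter> prod_set n B \<subseteq> \<sigma>" using img PB_fix by (metis Int_iff imageI subsetI)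
  qed
  have Psi_sig: "vapply \<Psi> x \<in> \<sigma>" if "x \<in> \<rho>" for x using img that by blast
  have a_PB: "\<alpha> \<in> prod_set n B" using fixa im a_tup by (metis imageI)
  have a_ess: "\<exists>c. \<alpha>[i := c] \<in> \<sigma>" if i: "i < n" for i
  proof -
    \<comment> \<open>Essentiality gives some tuple whose lines all meet \<rho>; the key property of
      \<alpha> carries it, together with its lines, to \<alpha>.\<close>
    obtain \<gamma> where g: "\<gamma> \<in> tuples A n - \<rho>" "\<And>i. i < n \<Longrightarrow> \<exists>c\<in>A. \<gamma>[i := c] \<in> \<rho>"
      using essential_obtains[OF ess] n by (metis One_nat_def Suc_1 Suc_leD)
    obtain \<Phi> where p: "uvf A n \<Phi>" "preserves \<Phi> \<rho>" "vapply \<Phi> \<gamma> = \<alpha>"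
      using ka g(1) by (auto simp: key_tuple_def)
    obtain c where "\<gamma>[i := c] \<in> \<rho>" using g(2)[OF i] by blast
    hence "vapply \<Psi> (vapply \<Phi> (\<gamma>[i := c])) \<in> \<sigma>" using p Psi_sig by (simp add: preserves_def)
    moreover have "vapply \<Psi> (vapply \<Phi> (\<gamma>[i := c])) = \<alpha>[i := \<Psi> i (\<Phi> i c)]"
      using i g(1) p(3) fixa a_tup by (simp add: vapply_list_update mem_tuples_iff)
    ultimately show ?thesis by metis
  qed
  have proj: "\<exists>x\<in>\<sigma>. x ! i = b" if i: "i < n" and b: "b \<in> B i" for i b
  proof (rule ccontr)
    assume no: "\<not> ?thesis"
    \<comment> \<open>\<open>r\<close> retracts the values that no tuple of \<sigma> takes in
      coordinate \<open>i\<close> onto the value of \<alpha>. It fixes \<sigma> and \<alpha>, so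
      composing it with the core map would shrink the image.\<close>
    define r where "r j y = (if j = i \<and> \<not> (\<exists>x\<in>\<sigma>. x ! i = y) then \<alpha> ! i else y)" for j y
    \<comment> \<open>A line through \<alpha> in another direction meets \<sigma>, so the value of
      \<alpha> is itself taken; this makes \<open>r\<close> idempotent.\<close>
    have a_pr: "\<exists>x\<in>\<sigma>. x ! i = \<alpha> ! i"
    proof -
      obtain j where "j < n" "j \<noteq> i" using n i by (metis One_nat_def Suc_1 less_le_trans lessI zero_less_Suc zero_neq_one)
      then obtain c where "\<alpha>[j := c] \<in> \<sigma>" using a_ess by blast
      thus ?thesis using \<open>j \<noteq> i\<close> by (intro bexI[of _ "\<alpha>[j := c]"]) auto
    qed
    define \<Psi>' where "\<Psi>' j = r j \<circ> \<Psi> j" for j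
    have rB: "r j y \<in> B j" if "j < n" "y \<in> B j" for j y
      using that a_PB by (auto simp: r_def mem_prod_set_iff)
    have inB: "\<Psi> j x \<in> B j" if "x \<in> A" for j x using that by (auto simp: B_def)
    have rr: "r j (r j y) = r j y" for j y using a_pr by (auto simp: r_def)
    have u': "uvf A n \<Psi>'" using rB inB B_sub unfolding uvf_def \<Psi>'_def by fastforce
    have r_sig: "vapply r x = x" if "x \<in> \<sigma>" for x
      using that by (intro vapply_ident) (auto simp: r_def)
    have p': "preserves \<Psi>' \<rho>"
      unfolding preserves_def \<Psi>'_def vapply_vapply[symmetric] using Psi_sig r_sig sr by auto
    have f': "vapply \<Psi>' \<alpha> = \<alpha>"
      unfolding \<Psi>'_def vapply_vapply[symmetric] fixa by (intro vapply_ident) (auto simp: r_def)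
    have i': "\<Psi>' j (\<Psi>' j x) = \<Psi>' j x" if "j < n" "x \<in> A" for j x
      using B_fix[OF that(1) rB[OF that(1) inB[OF that(2)]]] rr by (simp add: \<Psi>'_def)
    have cf': "core_fun A n \<rho> \<Psi>'" unfolding core_fun_def using u' p' f' i' ka by blast
    have "vapply \<Psi>' ` tuples A n \<subseteq> prod_set n B"
      using rB inB by (auto simp: mem_prod_set_iff mem_tuples_iff \<Psi>'_def)
    moreover have "\<alpha>[i := b] \<in> prod_set n B" using a_PB b by (simp add: prod_set_update)
    moreover have "\<alpha>[i := b] \<notin> vapply \<Psi>' ` tuples A n"
    proof
      assume "\<alpha>[i := b] \<in> vapply \<Psi>' ` tuples A n"
      then obtain x where x: "x \<in> tuples A n" "\<alpha>[i := b] = vapply \<Psi>' x" by blast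
      have "b = \<Psi>' i (x ! i)"
        using arg_cong[OF x(2), of "\<lambda>z. z ! i"] i x(1) a_tup by (simp add: mem_tuples_iff)
      hence "b = \<alpha> ! i \<or> (\<exists>x\<in>\<sigma>. x ! i = b)" by (auto simp: \<Psi>'_def r_def split: if_splits)
      thus False using no a_pr by blast
    qed
    ultimately have "vapply \<Psi>' ` tuples A n \<subset> prod_set n B" by (metis psubsetI)
    thus False using min[OF cf'] im by simp
  qed
  have map_B: "\<Theta> i b \<in> B i" if H: "preserves \<Theta> \<sigma>" "i < n" "b \<in> B i" for \<Theta> i b
  proof -
    obtain x where "x \<in> \<sigma>" "x ! i = b" using proj H by blast
    have "vapply \<Theta> x \<in> prod_set n B" using that \<open>x \<in> \<sigma>\<close> sig_eq by (auto simp: preserves_def)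
    thus ?thesis using \<open>x ! i = b\<close> that(2) \<open>x \<in> \<sigma>\<close> sig_eq by (auto simp: mem_prod_set_iff)
  qed
  have map_PB: "vapply \<Theta> x \<in> prod_set n B" if "preserves \<Theta> \<sigma>" "x \<in> prod_set n B" for \<Theta> x
    using map_B[OF that(1)] that(2) by (auto simp: mem_prod_set_iff)
  have reach: "\<exists>\<Phi>. uvf A n \<Phi> \<and> preserves \<Phi> \<sigma> \<and> vapply \<Phi> \<alpha> = \<beta>" if "key_tuple A n \<sigma> \<beta>" for \<beta>
    using that a_tup a_notin sr by (auto simp: key_tuple_def)
  have key_sub: "\<beta> \<in> prod_set n B" if "key_tuple A n \<sigma> \<beta>" for \<beta>
    using reach[OF that] map_PB a_PB by blast
  have key_line: "\<exists>c. \<beta>[i := c] \<in> \<sigma>" if H: "key_tuple A n \<sigma> \<beta>" "i < n" for \<beta> i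
  proof -
    obtain \<Phi> where p: "preserves \<Phi> \<sigma>" "vapply \<Phi> \<alpha> = \<beta>" using reach H by blast
    obtain c where "\<alpha>[i := c] \<in> \<sigma>" using a_ess H by blast
    hence "vapply \<Phi> (\<alpha>[i := c]) \<in> \<sigma>" using p by (simp add: preserves_def)
    thus ?thesis using p that a_tup by (auto simp: vapply_list_update mem_tuples_iff)
  qed
  have inj: "inj_on (\<Theta> i) (B i)"
    if kb: "key_tuple A n \<sigma> \<beta>" and ut: "uvf A n \<Theta>" and pt: "preserves \<Theta> \<sigma>" and nk: "vapply \<Theta> \<beta> \<notin> \<sigma>" and i: "i < n"
    for \<beta> \<Theta> i
  proof -
    obtain \<Phi>1 where p1: "uvf A n \<Phi>1" "preserves \<Phi>1 \<sigma>" "vapply \<Phi>1 \<alpha> = \<beta>" using reach[OF kb] by blast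
    have tb: "vapply \<Theta> \<beta> \<in> prod_set n B" using map_PB[OF pt key_sub[OF kb]] .
    hence "vapply \<Theta> \<beta> \<in> tuples A n - \<rho>" using nk sig_eq PB_tup by blast
    then obtain \<Phi>2 where p2: "uvf A n \<Phi>2" "preserves \<Phi>2 \<rho>" "vapply \<Phi>2 (vapply \<Theta> \<beta>) = \<alpha>"
      using ka by (auto simp: key_tuple_def)
    \<comment> \<open>The round trip from \<alpha> through \<beta> and back. \<open>\<Phi>1\<close>
      and \<open>\<Theta>\<close> are only known to preserve \<sigma>, so the inner \<Psi> first
      moves \<rho> into \<sigma>; the outer \<Psi> confines the image to the product of the
      \<open>B i\<close>.\<close>
    define \<Omega> where "\<Omega> j = \<Psi> j \<circ> (\<Phi>2 j \<circ> (\<Theta> j \<circ> (\<Phi>1 j \<circ> \<Psi> j)))" for j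
    have uO: "uvf A n \<Omega>" unfolding \<Omega>_def by (intro uvf_comp uvf p1 p2 ut)
    have pO: "preserves \<Omega> \<rho>"
      unfolding preserves_def \<Omega>_def vapply_vapply[symmetric]
      using Psi_sig p1(2) pt p2(2) sr unfolding preserves_def by blast
    have fO: "vapply \<Omega> \<alpha> = \<alpha>"
      unfolding \<Omega>_def vapply_vapply[symmetric] fixa p1(3) p2(3) ..
    obtain k where k: "k \<ge> 1" "\<And>i x. i < n \<Longrightarrow> x \<in> A \<Longrightarrow> (\<Omega> i ^^ k) ((\<Omega> i ^^ k) x) = (\<Omega> i ^^ k) x"
      using uvf_idempotent_power[OF fin uO] by blast
    define \<Psi>' where "\<Psi>' = (\<lambda>j. \<Omega> j ^^ k)"
    have f': "vapply \<Psi>' \<alpha> = \<alpha>"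
    proof -
      have "(vapply \<Omega> ^^ r) \<alpha> = \<alpha>" for r by (induction r) (auto simp: fO)
      thus ?thesis by (simp add: \<Psi>'_def vapply_pow)
    qed
    have "core_fun A n \<rho> \<Psi>'"
      unfolding core_fun_def
    proof (intro conjI exI[of _ \<alpha>] ka f')
      show "uvf A n \<Psi>'" using uvf_pow[OF uO] by (simp add: uvf_def \<Psi>'_def)
      show "preserves \<Psi>' \<rho>" unfolding \<Psi>'_def by (rule preserves_pow[OF pO])
      show "\<forall>i<n. \<forall>x\<in>A. \<Psi>' i (\<Psi>' i x) = \<Psi>' i x" using k(2) by (simp add: \<Psi>'_def)
    qed
    hence "\<not> vapply \<Psi>' ` tuples A n \<subset> prod_set n B" using min im by simp
    moreover have in_B: "\<Psi>' j x \<in> B j" if "j < n" "x \<in> A" for j x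
    proof -
      obtain r where r: "k = Suc r" using k(1) by (cases k) auto
      have "(\<Omega> j ^^ r) x \<in> A" using uvf_pow[OF uO that] .
      hence "\<Phi>2 j (\<Theta> j (\<Phi>1 j (\<Psi> j ((\<Omega> j ^^ r) x)))) \<in> A"
        using uvf p1(1) p2(1) ut that(1) by (simp add: uvf_def)
      thus ?thesis by (simp add: \<Psi>'_def r B_def \<Omega>_def)
    qed
    hence "vapply \<Psi>' ` tuples A n \<subseteq> prod_set n B" by (auto simp: mem_prod_set_iff mem_tuples_iff)
    ultimately have eq: "vapply \<Psi>' ` tuples A n = prod_set n B" by blast
    have id: "\<Psi>' i b = b" if b: "b \<in> B i" for b
    proof -
      have "\<alpha>[i := b] \<in> vapply \<Psi>' ` tuples A n" using eq a_PB b by (simp add: prod_set_update)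
      then obtain x where x: "x \<in> tuples A n" "\<alpha>[i := b] = vapply \<Psi>' x" by blast
      have "b = \<Psi>' i (x ! i)"
        using arg_cong[OF x(2), of "\<lambda>z. z ! i"] i x(1) a_tup by (simp add: mem_tuples_iff)
      thus ?thesis using k(2)[OF i, of "x ! i"] x(1) i by (auto simp: \<Psi>'_def mem_tuples_iff)
    qed
    have injO: "inj_on (\<Omega> i) (B i)"
    proof (rule inj_onI)
      fix x y assume xy: "x \<in> B i" "y \<in> B i" "\<Omega> i x = \<Omega> i y"
      obtain r where r: "k = Suc r" using k(1) by (cases k) auto
      have "\<Psi>' i x = \<Psi>' i y" using xy(3) by (simp only: \<Psi>'_def r funpow_Suc_right o_apply)
      thus "x = y" using id xy by simp
    qed
    have inj1: "inj_on (\<Phi>1 i) (B i)"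
    proof (rule inj_onI)
      fix x y assume xy: "x \<in> B i" "y \<in> B i" "\<Phi>1 i x = \<Phi>1 i y"
      hence "\<Omega> i x = \<Omega> i y" using B_fix[OF i] by (simp add: \<Omega>_def)
      thus "x = y" using injO xy by (simp add: inj_on_eq_iff)
    qed
    have finB: "finite (B i)" using fin by (simp add: B_def)
    \<comment> \<open>Injectivity of the composite constrains \<open>\<Theta>\<close> only on the
      image of \<open>\<Phi>1\<close>; this image is all of \<open>B i\<close>.\<close>
    have surj1: "\<Phi>1 i ` B i = B i"
      using inj1 finB map_B[OF p1(2) i] by (intro endo_inj_surj) auto
    show ?thesis
    proof (rule inj_onI)
      fix x y assume xy: "x \<in> B i" "y \<in> B i" "\<Theta> i x = \<Theta> i y"
      then obtain x' y' where x': "x' \<in> B i" "x = \<Phi>1 i x'" and y': "y' \<in> B i" "y = \<Phi>1 i y'"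
        using surj1 by (metis imageE)
      hence "\<Omega> i x' = \<Omega> i y'" using B_fix[OF i] xy(3) by (simp add: \<Omega>_def)
      thus "x = y" using injO x' y' by (simp add: inj_on_eq_iff)
    qed
  qed
  have "core_relation A n \<sigma> B"
  proof (unfold_locales)
    show "\<sigma> \<subseteq> prod_set n B" using sig_eq by blast
  qed (use fin B_sub proj key_sub key_line inj in blast)+
  thus ?thesis by blast
qed

section \<open>Key blocks preserved by a WNU vector-function\<close>

text \<open>The tuple \<open>s\<close> is rewritten into \<open>y\<close> entry by entry, through
  hybrids that agree with \<open>y\<close> up to a position and with \<open>s\<close> from there
  on.\<close>

lemma prod_set_induct:
  assumes s: "s \<in> prod_set n S" "P s"
    and step: "\<And>z j c. z \<in> prod_set n S \<Longrightarrow> P z \<Longrightarrow> j < n \<Longrightarrow> c \<in> S j \<Longrightarrow> P (z[j := c])"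
    and y: "y \<in> prod_set n S"
  shows "P y"
proof -
  have len: "length s = n" "length y = n" using s y by (auto simp: mem_prod_set_iff)
  have "t \<le> n \<Longrightarrow> take t y @ drop t s \<in> prod_set n S \<and> P (take t y @ drop t s)" for t
  proof (induction t)
    case 0 show ?case using s by simp
  next
    case (Suc t)
    hence IH: "take t y @ drop t s \<in> prod_set n S" "P (take t y @ drop t s)" and t: "t < n" by auto
    have eq: "take (Suc t) y @ drop (Suc t) s = (take t y @ drop t s)[t := y ! t]"
      using t len by (intro nth_equalityI) (auto simp: nth_append nth_list_update less_Suc_eq)
    have "y ! t \<in> S t" using y t by (simp add: mem_prod_set_iff)
    thus ?case unfolding eq using step[OF IH t] prod_set_update[OF IH(1)] by simp
  qed
  from this[of n] show ?thesis using len by simp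
qed

context core_relation begin

abbreviation K where "K \<equiv> key_tuple A n \<sigma>"

lemma sig_tuples: "x \<in> \<sigma> \<Longrightarrow> x \<in> tuples A n"
  using sig_sub B_sub by (force simp: mem_tuples_iff mem_prod_set_iff)

lemma sig_length: "x \<in> \<sigma> \<Longrightarrow> length x = n"
  using sig_tuples by (simp add: mem_tuples_iff)

text \<open>By injectivity the map permutes the finite \<sigma>, so a tuple outside \<sigma> finds
  its possible images in \<sigma> already occupied.\<close>

lemma reflects_if_not_kill:
  assumes "K \<beta>" "uvf A n \<Theta>" "preserves \<Theta> \<sigma>" "vapply \<Theta> \<beta> \<notin> \<sigma>"
    and y: "y \<in> prod_set n B" "vapply \<Theta> y \<in> \<sigma>"
  shows "y \<in> \<sigma>"
proof -
  have inj: "inj_on (vapply \<Theta>) (prod_set n B)"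
  proof (rule inj_onI)
    fix u v assume uv: "u \<in> prod_set n B" "v \<in> prod_set n B" "vapply \<Theta> u = vapply \<Theta> v"
    show "u = v"
    proof (rule nth_equalityI)
      fix i assume i: "i < length u"
      have "\<Theta> i (u ! i) = \<Theta> i (v ! i)"
        using nth_vapply[of i u \<Theta>] nth_vapply[of i v \<Theta>] i uv by (simp add: mem_prod_set_iff)
      thus "u ! i = v ! i"
        using inj_on_if_not_kill[OF assms(1-4), of i] uv i by (auto simp: mem_prod_set_iff inj_on_eq_iff)
    qed (use uv in \<open>simp add: mem_prod_set_iff\<close>)
  qed
  have "finite \<sigma>" using finite_subset[OF _ finite_tuples[OF fin]] sig_tuples by blast
  moreover have "vapply \<Theta> ` \<sigma> \<subseteq> \<sigma>" using assms(3) by (auto simp: preserves_def)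
  moreover have "inj_on (vapply \<Theta>) \<sigma>" using inj sig_sub by (rule inj_on_subset)
  ultimately have "vapply \<Theta> ` \<sigma> = \<sigma>" by (rule endo_inj_surj)
  then obtain z where "z \<in> \<sigma>" "vapply \<Theta> z = vapply \<Theta> y" using y by (metis imageE)
  thus ?thesis using inj y sig_sub by (metis inj_on_eq_iff subsetD)
qed

lemma key_image:
  assumes "K \<beta>" "uvf A n \<Theta>" "preserves \<Theta> \<sigma>" "vapply \<Theta> \<beta> \<notin> \<sigma>"
  shows "K (vapply \<Theta> \<beta>)"
  unfolding key_tuple_def
proof (intro conjI ballI)
  show "vapply \<Theta> \<beta> \<in> tuples A n - \<sigma>" using assms vapply_tuples by (auto simp: key_tuple_def)
  fix \<alpha> assume "\<alpha> \<in> tuples A n - \<sigma>"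
  then obtain \<Phi> where "uvf A n \<Phi>" "preserves \<Phi> \<sigma>" "vapply \<Phi> \<alpha> = \<beta>"
    using assms(1) by (auto simp: key_tuple_def)
  thus "\<exists>\<Psi>. uvf A n \<Psi> \<and> preserves \<Psi> \<sigma> \<and> vapply \<Psi> \<alpha> = vapply \<Theta> \<beta>"
    using assms uvf_comp preserves_comp vapply_vapply by metis
qed

end

locale wnu_block = core_relation +
  fixes m :: nat and F :: "nat \<Rightarrow> 'a list \<Rightarrow> 'a" and As :: "nat \<Rightarrow> 'a set"
  assumes n3: "n \<ge> 3"
    and full: "full_pattern A n \<sigma>"
    and wnuF: "wnu_vf_preserves A n m F \<sigma>"
    and blk: "key_block A n \<sigma> (prod_set n As)"
begin

abbreviation D where "D \<equiv> prod_set n As"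
abbreviation Q where "Q \<equiv> \<sigma> \<inter> D"

text \<open>The full pattern in the form used below: \<open>x\<close> and \<open>y\<close> are the
  neighbours of \<open>a\<close> in directions \<open>i\<close> and \<open>j\<close>, and
  \<open>z\<close> is the opposite corner.\<close>

lemma rectangle:
  assumes "a \<in> tuples A n" "x \<in> \<sigma>" "y \<in> \<sigma>" "z \<in> \<sigma>" "i < n" "j < n" "i \<noteq> j"
    and "\<And>l. l < n \<Longrightarrow> l \<noteq> i \<Longrightarrow> x ! l = a ! l"
    and "\<And>l. l < n \<Longrightarrow> l \<noteq> j \<Longrightarrow> y ! l = a ! l"
    and "\<And>l. l < n \<Longrightarrow> l \<noteq> i \<Longrightarrow> l \<noteq> j \<Longrightarrow> z ! l = a ! l"
    and "z ! i = x ! i" "z ! j = y ! j"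
  shows "a \<in> \<sigma>"
proof (rule ccontr)
  assume "a \<notin> \<sigma>"
  have len: "length a = n" "length x = n" "length y = n" "length z = n"
    using assms sig_length by (auto simp: mem_tuples_iff)
  have "a[i := x ! i] = x" "a[j := y ! j] = y" "a[i := x ! i, j := y ! j] = z"
    using assms len by (auto intro!: nth_equalityI simp: nth_list_update)
  moreover have "x ! i \<in> A" "y ! j \<in> A" using assms sig_tuples by (auto simp: mem_tuples_iff)
  moreover have "\<not> (\<exists>a\<in>tuples A n. \<exists>bi\<in>A. \<exists>bj\<in>A. a \<notin> \<sigma> \<and>
     a[i := bi] \<in> \<sigma> \<and> a[j := bj] \<in> \<sigma> \<and> a[i := bi, j := bj] \<in> \<sigma>)"
    using full assms(5-7) by (simp add: full_pattern_def pattern_rel_def)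
  ultimately show False using assms(1-4) \<open>a \<notin> \<sigma>\<close> by metis
qed

lemma wnu_F: "i < n \<Longrightarrow> wnu A m (F i)"
  using wnuF unfolding wnu_vf_preserves_def by blast

lemma F_in: "i < n \<Longrightarrow> xs \<in> tuples A m \<Longrightarrow> F i xs \<in> A"
  and F_idem: "i < n \<Longrightarrow> x \<in> A \<Longrightarrow> F i (replicate m x) = x"
  and F_wnu: "i < n \<Longrightarrow> x \<in> A \<Longrightarrow> y \<in> A \<Longrightarrow> k < m \<Longrightarrow>
     F i ((replicate m x)[k := y]) = F i ((replicate m x)[0 := y])"
  using wnu_F unfolding wnu_def by blast+

lemma m2: "m \<ge> 2"
  using wnu_F[of 0] n3 unfolding wnu_def by simp

definition ap :: "'a list list \<Rightarrow> 'a list" where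
  "ap ts = map (\<lambda>i. F i (map (\<lambda>t. t ! i) ts)) [0..<n]"

lemma length_ap [simp]: "length (ap ts) = n" by (simp add: ap_def)

lemma nth_ap [simp]: "i < n \<Longrightarrow> ap ts ! i = F i (map (\<lambda>t. t ! i) ts)" by (simp add: ap_def)

lemma ap_sig: "length ts = m \<Longrightarrow> set ts \<subseteq> \<sigma> \<Longrightarrow> ap ts \<in> \<sigma>"
  using wnuF by (simp add: wnu_vf_preserves_def ap_def)

lemma ap_tuples: "length ts = m \<Longrightarrow> set ts \<subseteq> tuples A n \<Longrightarrow> ap ts \<in> tuples A n"
  unfolding mem_tuples_iff[of "ap ts"]
  by (auto intro!: F_in simp: mem_tuples_iff[of "map _ _"]) (meson mem_tuples_iff nth_mem subsetD)

lemma D_Key: "D \<subseteq> Key A n \<sigma>"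
  and D_adjacent: "x \<in> D \<Longrightarrow> y \<in> Key A n \<sigma> \<Longrightarrow> adjacent n x y \<Longrightarrow> y \<in> D"
  and D_nonmember: "\<exists>\<beta>\<in>D. \<beta> \<notin> \<sigma> \<and> K \<beta>"
proof -
  let ?R = "\<lambda>x y. x \<in> Key A n \<sigma> \<and> y \<in> Key A n \<sigma> \<and> adjacent n x y"
  obtain \<beta> where b: "K \<beta>" "D = {ys. ?R\<^sup>*\<^sup>* \<beta> ys}" using blk unfolding key_block_def by blast
  show sub: "D \<subseteq> Key A n \<sigma>"
  proof
    fix y assume "y \<in> D"
    hence "?R\<^sup>*\<^sup>* \<beta> y" using b by blast
    thus "y \<in> Key A n \<sigma>" by cases (use b in \<open>auto simp: Key_def\<close>)
  qed
  have "\<beta> \<in> D" using b by auto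
  thus "\<exists>\<beta>\<in>D. \<beta> \<notin> \<sigma> \<and> K \<beta>" using b(1) by (auto simp: key_tuple_def)
  show "y \<in> D" if "x \<in> D" "y \<in> Key A n \<sigma>" "adjacent n x y"
  proof -
    have "?R\<^sup>*\<^sup>* \<beta> x" "?R x y" using that sub b by auto
    hence "?R\<^sup>*\<^sup>* \<beta> y" by (rule rtranclp.rtrancl_into_rtrancl)
    thus ?thesis using b by blast
  qed
qed

lemma D_key: "x \<in> D \<Longrightarrow> x \<notin> \<sigma> \<Longrightarrow> K x"
  using D_Key by (auto simp: Key_def)

lemma D_B: "x \<in> D \<Longrightarrow> x \<in> prod_set n B"
  using D_key key_sub sig_sub by blast

lemma D_tuples: "x \<in> D \<Longrightarrow> x \<in> tuples A n"
  using D_B B_sub by (force simp: mem_tuples_iff mem_prod_set_iff)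

lemma D_length: "x \<in> D \<Longrightarrow> length x = n" by (simp add: mem_prod_set_iff)

lemma D_update: "x \<in> D \<Longrightarrow> c \<in> As i \<Longrightarrow> x[i := c] \<in> D"
  by (simp add: prod_set_update)

lemma As_B: "i < n \<Longrightarrow> As i \<subseteq> B i"
proof
  fix c assume i: "i < n" and c: "c \<in> As i"
  obtain \<beta> where "\<beta> \<in> D" using D_nonmember by blast
  hence "\<beta>[i := c] \<in> prod_set n B" "length \<beta> = n" using D_update c D_B D_length by blast+
  thus "c \<in> B i" using i by (auto simp: mem_prod_set_iff)
qed

lemma As_A: "i < n \<Longrightarrow> As i \<subseteq> A" using As_B B_sub by blast

text \<open>A connected component cannot be left along an edge; the case \<open>y = x\<close>, which
  is no edge, is treated separately.\<close>

lemma D_closed: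
  assumes x: "x \<in> D" and y: "y \<in> \<sigma> \<or> K y" and l: "length y = n" and i: "i < n"
    and eq: "\<And>l. l < n \<Longrightarrow> l \<noteq> i \<Longrightarrow> y ! l = x ! l"
  shows "y \<in> D"
proof (cases "y ! i = x ! i")
  case True
  hence "y = x" using eq l D_length[OF x] by (intro nth_equalityI) (metis+)
  thus ?thesis using x by simp
next
  case False
  have "{l. l < n \<and> x ! l \<noteq> y ! l} = {i}" using eq False i by force
  hence "adjacent n x y" using l D_length[OF x] by (simp add: adjacent_def)
  thus ?thesis using x y by (intro D_adjacent[OF x]) (auto simp: Key_def)
qed

lemma line:
  assumes x: "x \<in> D" and i: "i < n"
  obtains c where "c \<in> As i" "x[i := c] \<in> \<sigma>"
proof (cases "x \<in> \<sigma>")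
  case True
  thus ?thesis using that[of "x ! i"] x i by (auto simp: mem_prod_set_iff)
next
  case False
  then obtain c where c: "x[i := c] \<in> \<sigma>" using key_line D_key x i by blast
  have "x[i := c] \<in> D" using D_length[OF x] by (intro D_closed[OF x _ _ i]) (auto simp: c)
  thus ?thesis using that[of c] c i D_length[OF x] by (auto simp: mem_prod_set_iff)
qed

text \<open>If one line in direction \<open>k\<close> lay in \<sigma>, rectangularity would spread
  this to all parallel lines, one coordinate at a time, and the block would contain no key
  tuple.\<close>

lemma line_not_full:
  assumes s: "s \<in> D" and k: "k < n"
  obtains b where "b \<in> As k" "s[k := b] \<notin> \<sigma>"
proof (rule ccontr)
  assume "\<not> thesis"
  hence fl: "\<forall>b\<in>As k. s[k := b] \<in> \<sigma>" using that by blast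
  have "\<forall>b\<in>As k. y[k := b] \<in> \<sigma>" if "y \<in> D" for y
  proof (rule prod_set_induct[where P = "\<lambda>y. \<forall>b\<in>As k. y[k := b] \<in> \<sigma>", OF s fl _ that])
    fix z j c assume z: "z \<in> D" and IH: "\<forall>b\<in>As k. z[k := b] \<in> \<sigma>" and j: "j < n" and c: "c \<in> As j"
    show "\<forall>b\<in>As k. z[j := c, k := b] \<in> \<sigma>"
    proof (cases "j = k")
      case True thus ?thesis using IH by simp
    next
      case False
      note zl = D_length[OF z]
      obtain e where e: "e \<in> As k" "z[j := c, k := e] \<in> \<sigma>" using line[OF D_update[OF z c] k] .
      show ?thesis
      proof
        fix b assume b: "b \<in> As k"
        show "z[j := c, k := b] \<in> \<sigma>"
        proof (rule rectangle[where i = j and j = k and x = "z[k := b]" and y = "z[j := c, k := e]" and z = "z[k := e]"])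
          show "z[j := c, k := b] \<in> tuples A n" using D_tuples[OF D_update[OF D_update[OF z c] b]] .
        qed (use False IH b e j k zl in \<open>auto simp: nth_list_update\<close>)
      qed
    qed
  qed
  hence "y \<in> \<sigma>" if "y \<in> D" for y using that k by (metis list_update_id mem_prod_set_iff)
  thus False using D_nonmember by blast
qed

text \<open>Changing a single entry may leave \<sigma>. The last coordinate therefore serves as a
  buffer, reset after each correction of another entry to restore membership.\<close>

lemma Q_induct:
  assumes s: "s \<in> Q" "P s"
    and step: "\<And>w i j a b. w \<in> Q \<Longrightarrow> P w \<Longrightarrow> i < n \<Longrightarrow> j < n \<Longrightarrow> i \<noteq> j \<Longrightarrow> a \<in> As i \<Longrightarrow> b \<in> As j \<Longrightarrow>
      w[i := a, j := b] \<in> \<sigma> \<Longrightarrow> P (w[i := a, j := b])"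
    and y: "y \<in> Q"
  shows "P y"
proof -
  define N where "N = n - 1"
  have N: "N < n" "N \<noteq> 0" "n = Suc N" using n3 by (auto simp: N_def)
  have "t \<le> N \<Longrightarrow> \<exists>w\<in>Q. P w \<and> (\<forall>l<t. w ! l = y ! l)" for t
  proof (induction t)
    case 0 show ?case using s by auto
  next
    case (Suc t)
    then obtain w where w: "w \<in> Q" "P w" "\<forall>l<t. w ! l = y ! l" by auto
    have t: "t < n" "t \<noteq> N" "y ! t \<in> As t" using Suc N y by (auto simp: mem_prod_set_iff)
    have "w[t := y ! t] \<in> D" using w t D_update by blast
    then obtain c where c: "c \<in> As N" "w[t := y ! t, N := c] \<in> \<sigma>" using line N(1) by blast
    have "w[t := y ! t, N := c] \<in> Q" using c w t D_update by blast
    moreover have "P (w[t := y ! t, N := c])" using step[OF w(1,2) t(1) N(1) t(2,3) c] .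
    moreover have "\<forall>l<Suc t. w[t := y ! t, N := c] ! l = y ! l"
      using w(3) t Suc.prems D_length[of w] w(1) by (auto simp: nth_list_update less_Suc_eq)
    ultimately show ?case by blast
  qed
  from this[of N] obtain w where w: "w \<in> Q" "P w" "\<forall>l<N. w ! l = y ! l" by auto
  have yy: "y ! N \<in> As N" "y ! 0 \<in> As 0" using y N by (auto simp: mem_prod_set_iff)
  \<comment> \<open>Only entry \<open>N\<close> can still differ; the update in coordinate 0 is
    vacuous and merely gives the move its required form.\<close>
  have "w[N := y ! N, 0 := y ! 0] = y"
    using w N D_length[of w] D_length[of y] y
    by (intro nth_equalityI) (auto simp: nth_list_update less_Suc_eq)
  thus ?thesis using step[OF w(1,2) N(1) _ N(2) yy] y N by auto
qed

section \<open>Polynomials of the WNU with one free argument\<close>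

lemma ap_update_vapply:
  assumes "length u = m" "p < m" "length x = n"
  shows "ap (u[p := x]) = vapply (\<lambda>i v. F i ((map (\<lambda>t. t ! i) u)[p := v])) x"
  using assms by (intro nth_equalityI) (auto simp: map_update)

lemma poly_uvf:
  assumes "length u = m" "p < m" "\<And>l. l < m \<Longrightarrow> l \<noteq> p \<Longrightarrow> u ! l \<in> \<sigma>"
  shows "uvf A n (\<lambda>i v. F i ((map (\<lambda>t. t ! i) u)[p := v]))"
  unfolding uvf_def
proof (intro allI impI ballI F_in)
  fix i v assume "i < n" "v \<in> A"
  have "(map (\<lambda>t. t ! i) u)[p := v] ! l \<in> A" if "l < m" for l
    using assms(3)[OF that] that assms(1,2) \<open>v \<in> A\<close> \<open>i < n\<close> sig_tuples by (cases "l = p") (auto simp: mem_tuples_iff)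
  thus "(map (\<lambda>t. t ! i) u)[p := v] \<in> tuples A m" using assms(1) by (simp add: mem_tuples_iff)
qed

lemma ap_update_sig:
  assumes "length u = m" "p < m" "\<And>l. l < m \<Longrightarrow> l \<noteq> p \<Longrightarrow> u ! l \<in> \<sigma>" "x \<in> \<sigma>"
  shows "ap (u[p := x]) \<in> \<sigma>"
proof (rule ap_sig)
  have "u[p := x] ! l \<in> \<sigma>" if "l < m" for l using assms that by (cases "l = p") auto
  thus "set (u[p := x]) \<subseteq> \<sigma>" using assms(1) by (auto simp: set_conv_nth)
qed (use assms in simp)

lemma poly_preserves:
  assumes "length u = m" "p < m" "\<And>l. l < m \<Longrightarrow> l \<noteq> p \<Longrightarrow> u ! l \<in> \<sigma>"
  shows "preserves (\<lambda>i v. F i ((map (\<lambda>t. t ! i) u)[p := v])) \<sigma>"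
  unfolding preserves_def
proof
  fix x assume x: "x \<in> \<sigma>"
  show "vapply (\<lambda>i v. F i ((map (\<lambda>t. t ! i) u)[p := v])) x \<in> \<sigma>"
    using ap_update_sig[OF assms x] unfolding ap_update_vapply[OF assms(1,2) sig_length[OF x]] .
qed

lemma poly_reflects:
  assumes "length u = m" "p < m" "\<And>l. l < m \<Longrightarrow> l \<noteq> p \<Longrightarrow> u ! l \<in> \<sigma>"
    and "\<beta> \<in> D" "ap (u[p := \<beta>]) \<notin> \<sigma>"
    and "y \<in> prod_set n B" "ap (u[p := y]) \<in> \<sigma>"
  shows "y \<in> \<sigma>"
proof -
  have "\<beta> \<notin> \<sigma>" using ap_update_sig[OF assms(1-3)] assms(5) by blast
  thus ?thesis
    using reflects_if_not_kill[OF D_key[OF assms(4)] poly_uvf[OF assms(1-3)] poly_preserves[OF assms(1-3)]]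
      assms(5-7) ap_update_vapply[OF assms(1,2)] D_length[OF assms(4)] by (simp add: mem_prod_set_iff)
qed

lemma poly_inj:
  assumes "length u = m" "p < m" "\<And>l. l < m \<Longrightarrow> l \<noteq> p \<Longrightarrow> u ! l \<in> \<sigma>"
    and "\<beta> \<in> D" "ap (u[p := \<beta>]) \<notin> \<sigma>" "i < n"
  shows "inj_on (\<lambda>v. F i ((map (\<lambda>t. t ! i) u)[p := v])) (B i)"
proof -
  have "\<beta> \<notin> \<sigma>" using ap_update_sig[OF assms(1-3)] assms(5) by blast
  thus ?thesis
    using inj_on_if_not_kill[OF D_key[OF assms(4)] poly_uvf[OF assms(1-3)] poly_preserves[OF assms(1-3)]]
      assms(5,6) ap_update_vapply[OF assms(1,2)] D_length[OF assms(4)] by simp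
qed

lemma poly_key:
  assumes "length u = m" "p < m" "\<And>l. l < m \<Longrightarrow> l \<noteq> p \<Longrightarrow> u ! l \<in> \<sigma>"
    and "\<beta> \<in> D"
  shows "ap (u[p := \<beta>]) \<in> \<sigma> \<or> K (ap (u[p := \<beta>]))"
proof (cases "\<beta> \<in> \<sigma>")
  case True thus ?thesis using ap_update_sig[OF assms(1-3)] by blast
next
  case False
  thus ?thesis
    using key_image[OF D_key[OF assms(4)] poly_uvf[OF assms(1-3)] poly_preserves[OF assms(1-3)]]
    by (simp only: ap_update_vapply[OF assms(1,2) D_length[OF assms(4)]]) blast
qed

lemma ap_replicate: "s \<in> \<sigma> \<Longrightarrow> ap (replicate m s) = s"
  using sig_tuples[of s] by (intro nth_equalityI) (auto simp: F_idem mem_tuples_iff)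

text \<open>A two-coordinate move of one argument is split into two single changes. The middle tuple
  may lie outside \<sigma>, but it is then a key tuple, and its image is in \<sigma> or again a key
  tuple. So the image moves along edges and stays in the block.\<close>

lemma ap_D:
  assumes "ts \<in> prod_set m (\<lambda>_. Q)"
  shows "ap ts \<in> D"
proof -
  obtain s where s: "s \<in> Q"
  proof -
    obtain \<beta> where "\<beta> \<in> D" using D_nonmember by blast
    then obtain c where "c \<in> As 0" "\<beta>[0 := c] \<in> \<sigma>" using line n3 by (metis gr0I not_numeral_le_zero)
    thus ?thesis using that D_update[OF \<open>\<beta> \<in> D\<close>] by blast
  qed
  show ?thesis
  proof (rule prod_set_induct[where P = "\<lambda>ts. ap ts \<in> D", OF _ _ _ assms])
    show "replicate m s \<in> prod_set m (\<lambda>_. Q)" using s by (simp add: mem_prod_set_iff)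
    show "ap (replicate m s) \<in> D" using s ap_replicate by simp
    fix z p c assume z: "z \<in> prod_set m (\<lambda>_. Q)" and IH: "ap z \<in> D" and p: "p < m" and c: "c \<in> Q"
    have zl: "length z = m" "\<And>l. l < m \<Longrightarrow> l \<noteq> p \<Longrightarrow> z ! l \<in> \<sigma>" "z ! p \<in> Q"
      using z p by (auto simp: mem_prod_set_iff)
    have P0: "ap (z[p := z ! p]) \<in> D" using IH by simp
    show "ap (z[p := c]) \<in> D"
    proof (rule Q_induct[where P = "\<lambda>w. ap (z[p := w]) \<in> D", OF zl(3) P0 _ c])
      fix w i j a b
      assume w: "w \<in> Q" and IH: "ap (z[p := w]) \<in> D" and i: "i < n" and j: "j < n" and "i \<noteq> j"
        and a: "a \<in> As i" and b: "b \<in> As j" and w': "w[i := a, j := b] \<in> \<sigma>"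
      have wl: "length w = n" using w D_length by blast
      have mid: "w[i := a] \<in> D" using w a D_update by blast
      have 1: "ap (z[p := w[i := a]]) \<in> D"
        using poly_key[OF zl(1) p zl(2) mid] wl
        by (intro D_closed[OF IH _ _ i]) (auto simp: map_update)
      have "w[i := a, j := b] \<in> D" using mid b D_update by blast
      show "ap (z[p := w[i := a, j := b]]) \<in> D"
        using poly_key[OF zl(1) p zl(2) \<open>w[i := a, j := b] \<in> D\<close>] wl
        by (intro D_closed[OF 1 _ _ j]) (auto simp: map_update)
    qed
  qed
qed

lemma Q_through:
  assumes i: "i < n" and a: "a \<in> As i"
  obtains s where "s \<in> Q" "s ! i = a"
proof -
  obtain \<beta> where b: "\<beta> \<in> D" using D_nonmember by blast
  define j :: nat where "j = (if i = 0 then 1 else 0)"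
  have j: "j < n" "j \<noteq> i" using n3 by (auto simp: j_def)
  have "\<beta>[i := a] \<in> D" using D_update b a by blast
  then obtain c where c: "c \<in> As j" "\<beta>[i := a, j := c] \<in> \<sigma>" using line j by blast
  have "\<beta>[i := a, j := c] \<in> D" using D_update b a c by blast
  moreover have "\<beta>[i := a, j := c] ! i = a" using i j(2) D_length[OF b] by simp
  ultimately show ?thesis using that c by blast
qed

lemma F_closed:
  assumes i: "i < n" and xs: "length xs = m" "set xs \<subseteq> As i"
  shows "F i xs \<in> As i"
proof -
  have "\<exists>s. s \<in> Q \<and> s ! i = a" if "a \<in> As i" for a using Q_through[OF i that] by blast
  then obtain S where S: "\<And>a. a \<in> As i \<Longrightarrow> S a \<in> Q \<and> S a ! i = a" by metis
  have "map S xs \<in> prod_set m (\<lambda>_. Q)"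
    unfolding mem_prod_set_iff[of "map S xs"] using xs S by (simp add: subset_iff)
  hence "ap (map S xs) \<in> D" by (rule ap_D)
  moreover have "map ((\<lambda>t. t ! i) \<circ> S) xs = xs" using xs S by (intro map_idI) auto
  ultimately show ?thesis using i by (auto simp: mem_prod_set_iff)
qed

text \<open>By the dichotomy, each polynomial obtained from a good \<open>u\<close> by freeing one argument sends all key tuples
  into \<open>\<sigma>\<close>. Goodness survives moving one argument through \<open>Q\<close>.\<close>

definition good :: "'a list list \<Rightarrow> bool" where
  "good u \<longleftrightarrow> (\<forall>p<m. \<forall>x\<in>D. ap (u[p := x]) \<in> \<sigma>)"

text \<open>The case that matters frees an argument \<open>p\<close> other than \<open>l\<close>. By
  the dichotomy it suffices to send one key tuple \<beta> into \<sigma>. It is chosen to differ from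
  \<open>u ! p\<close> only in a coordinate \<open>k\<close> apart from \<open>i\<close> and
  \<open>j\<close>, so that rectangles in the directions \<open>i\<close>, \<open>k\<close> and
  \<open>j\<close>, \<open>k\<close> apply.\<close>

lemma good_step:
  assumes u: "u \<in> prod_set m (\<lambda>_. Q)" and g: "good u" and l: "l < m"
    and ij: "i < n" "j < n" "i \<noteq> j" and a: "a \<in> As i" and b: "b \<in> As j"
    and w': "(u ! l)[i := a, j := b] \<in> \<sigma>"
  shows "good (u[l := (u ! l)[i := a, j := b]])"
  unfolding good_def
proof (intro allI impI ballI)
  fix p x assume p: "p < m" and x: "x \<in> D"
  define w where "w = u ! l"
  have uu: "length u = m" "\<And>l. l < m \<Longrightarrow> u ! l \<in> Q" using u by (auto simp: mem_prod_set_iff)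
  have w: "w \<in> Q" "length w = n" using uu l D_length by (auto simp: w_def)
  define v where "v = w[i := a, j := b]"
  have v: "v \<in> \<sigma>" "v \<in> D" using w' w D_update a b by (auto simp: v_def w_def)
  show "ap (u[l := (u ! l)[i := a, j := b], p := x]) \<in> \<sigma>"
  proof (cases "p = l")
    case True thus ?thesis using g p x by (simp add: good_def)
  next
    case False
    have "card {i, j} \<le> 2" by (simp add: card_insert_if)
    hence "\<not> {..<n} \<subseteq> {i, j}" using n3 card_mono[of "{i, j}" "{..<n}"] by auto
    then obtain k where k: "k < n" "k \<noteq> i" "k \<noteq> j" by auto
    have up: "u ! p \<in> Q" "length (u ! p) = n" using uu p D_length by auto
    obtain b' where b': "b' \<in> As k" "(u ! p)[k := b'] \<notin> \<sigma>" using line_not_full up k(1) by blast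
    define \<beta> where "\<beta> = (u ! p)[k := b']"
    have be: "\<beta> \<in> D" "\<beta> \<notin> \<sigma>" "length \<beta> = n" using b' up D_update by (auto simp: \<beta>_def)
    define V where "V x y = ap (u[p := x, l := y])" for x y
    define mid where "mid = w[i := a]"
    have mid: "mid \<in> D" using w a D_update by (simp add: mid_def)
    have Vw: "V x w \<in> \<sigma>" if "x \<in> D" for x
    proof -
      have "u[p := x, l := w] = u[p := x]" using False uu(1) l
        by (intro nth_equalityI) (auto simp: w_def nth_list_update)
      thus ?thesis using g p that by (simp add: good_def V_def)
    qed
    have Vu: "V (u ! p) y \<in> \<sigma>" if "y \<in> D" for y using g l that by (simp add: good_def V_def)
    have Vt: "V x y \<in> tuples A n" if "x \<in> D" "y \<in> D" for x y
    proof -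
      have "set (u[p := x, l := y]) \<subseteq> insert y (insert x (set u))"
        by (meson set_update_subset_insert subset_trans insert_mono)
      moreover have "set u \<subseteq> D" using uu by (auto simp: set_conv_nth)
      ultimately have "set (u[p := x, l := y]) \<subseteq> tuples A n" using that D_tuples by blast
      thus ?thesis unfolding V_def using uu by (intro ap_tuples) auto
    qed
    have Vnth: "V x y ! q = F q ((map (\<lambda>t. t ! q) u)[p := x ! q, l := y ! q])" if "q < n" for x y q
      using that by (simp add: V_def map_update)
    have bq: "\<beta> ! q = u ! p ! q" if "q \<noteq> k" for q using that by (simp add: \<beta>_def)
    have mq: "mid ! q = w ! q" if "q \<noteq> i" for q using that by (simp add: mid_def)
    have vq: "v ! q = mid ! q" if "q \<noteq> j" for q using that by (simp add: v_def mid_def)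
    have upD: "u ! p \<in> D" using up by blast
    \<comment> \<open>The change from \<open>w\<close> to \<open>v\<close> passes through
      \<open>mid\<close>, one coordinate at a time; each opposite corner has \<open>u ! p\<close> in
      place of \<beta>.\<close>
    have 1: "V \<beta> mid \<in> \<sigma>"
      by (rule rectangle[OF Vt[OF be(1) mid] Vw[OF be(1)] Vu[OF mid] Vw[OF upD] ij(1) k(1)])
         (use k ij in \<open>simp_all add: Vnth bq mq\<close>)
    have 2: "V \<beta> v \<in> \<sigma>"
      by (rule rectangle[OF Vt[OF be(1) v(2)] 1 Vu[OF v(2)] Vu[OF mid] ij(2) k(1)])
         (use k ij in \<open>simp_all add: Vnth bq vq\<close>)
    have sw: "u[l := v, p := x] = u[p := x, l := v]" for x using False by (simp add: list_update_swap)
    show ?thesis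
    proof (rule ccontr)
      assume "\<not> ?thesis"
      hence nx: "ap (u[l := v, p := x]) \<notin> \<sigma>" by (simp add: v_def w_def)
      have "\<beta> \<in> \<sigma>"
      proof (rule poly_reflects[OF _ p _ x nx D_B[OF be(1)]])
        show "ap (u[l := v, p := \<beta>]) \<in> \<sigma>" using 2 by (simp add: sw V_def)
        show "u[l := v] ! q \<in> \<sigma>" if "q < m" "q \<noteq> p" for q
          using that uu v by (cases "q = l") auto
      qed (use uu in simp)
      thus False using be by blast
    qed
  qed
qed

lemma good_all:
  assumes s: "s \<in> Q" and g: "good (replicate m s)" and u: "u \<in> prod_set m (\<lambda>_. Q)"
  shows "good u"
proof (rule prod_set_induct[where P = good, OF _ g _ u])
  show "replicate m s \<in> prod_set m (\<lambda>_. Q)" using s by (simp add: mem_prod_set_iff)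
  fix z l c assume z: "z \<in> prod_set m (\<lambda>_. Q)" and IH: "good z" and l: "l < m" and c: "c \<in> Q"
  have zl: "length z = m" "z ! l \<in> Q" using z l by (auto simp: mem_prod_set_iff)
  have P0: "good (z[l := z ! l])" using IH by simp
  show "good (z[l := c])"
  proof (rule Q_induct[where P = "\<lambda>w. good (z[l := w])", OF zl(2) P0 _ c])
    fix w i j a b
    assume w: "w \<in> Q" "good (z[l := w])" and ij: "i < n" "j < n" "i \<noteq> j"
      and ab: "a \<in> As i" "b \<in> As j" "w[i := a, j := b] \<in> \<sigma>"
    have "z[l := w] \<in> prod_set m (\<lambda>_. Q)" using prod_set_update[OF z] w by blast
    from good_step[OF this w(2) l ij ab(1,2)] show "good (z[l := w[i := a, j := b]])"
      using ab(3) l zl by simp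
  qed
qed

text \<open>For a key tuple \<open>\<beta>\<close> with neighbours \<open>x\<close>, \<open>y\<close> in \<open>\<sigma>\<close> (differing from \<open>\<beta>\<close> in coordinates 0 and 1),
  induction on \<open>k\<close> gives \<open>f(\<beta>, \<dots>, \<beta>, y, \<dots>, y) \<in> \<sigma>\<close> with \<open>k\<close> copies of \<open>\<beta>\<close>; the rectangle is completed
  by the tuples \<open>f(x, \<dots>, x, y, \<dots>, y)\<close>.\<close>

lemma not_all_good: "\<exists>u\<in>prod_set m (\<lambda>_. Q). \<not> good u"
proof (rule ccontr)
  assume "\<not> ?thesis"
  hence g: "\<And>u. u \<in> prod_set m (\<lambda>_. Q) \<Longrightarrow> good u" by blast
  obtain \<beta> where be: "\<beta> \<in> D" "\<beta> \<notin> \<sigma>" using D_nonmember by blast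
  have l: "length \<beta> = n" using be D_length by blast
  have n01: "0 < n" "1 < n" using n3 by auto
  obtain c where c: "c \<in> As 0" "\<beta>[0 := c] \<in> \<sigma>" using line[OF be(1) n01(1)] .
  obtain d where d: "d \<in> As 1" "\<beta>[1 := d] \<in> \<sigma>" using line[OF be(1) n01(2)] .
  define x where "x = \<beta>[0 := c]"
  define y where "y = \<beta>[1 := d]"
  have xy: "x \<in> Q" "y \<in> Q" using c d be D_update by (auto simp: x_def y_def)
  define U where "U k = replicate k \<beta> @ replicate (m - k) y" for k
  define W where "W k = replicate k x @ replicate (m - k) y" for k
  have WQ: "W k \<in> prod_set m (\<lambda>_. Q)" if "k \<le> m" for k
    using xy that by (auto simp: W_def mem_prod_set_iff nth_append)
  have Wsig: "ap (W k) \<in> \<sigma>" if "k \<le> m" for k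
    using WQ[OF that] by (intro ap_sig) (auto simp: mem_prod_set_iff set_conv_nth)
  have "k \<le> m \<Longrightarrow> ap (U k) \<in> \<sigma>" for k
  proof (induction k)
    case 0
    show ?case using xy ap_replicate[of y] by (simp add: U_def)
  next
    case (Suc k)
    hence IH: "ap (U k) \<in> \<sigma>" and k: "k < m" by auto
    \<comment> \<open>Replacing one argument of \<open>W k\<close> by \<beta> yields the neighbour
      of \<open>ap (U (Suc k))\<close> in direction 0; \<open>ap (U k)\<close> is the one in
      direction 1.\<close>
    have W1: "ap ((W k)[k := \<beta>]) \<in> \<sigma>"
      using g[OF WQ[of k]] k be by (simp add: good_def)
    have eqm: "m - k = Suc (m - Suc k)" using k by simp
    have Wk: "(W k)[k := \<beta>] = replicate k x @ \<beta> # replicate (m - Suc k) y"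
      unfolding W_def eqm by (simp add: list_update_append)
    have tup: "ap (U (Suc k)) \<in> tuples A n"
      using be xy D_tuples Suc.prems by (intro ap_tuples) (auto simp: U_def)
    have cols: "map (\<lambda>t. t ! q) (U k) = replicate k (\<beta> ! q) @ replicate (m - k) (y ! q)"
      "map (\<lambda>t. t ! q) (W k) = replicate k (x ! q) @ replicate (m - k) (y ! q)" for k q
      by (auto simp: U_def W_def)
    have xq: "x ! q = \<beta> ! q" if "q \<noteq> 0" for q using that by (simp add: x_def)
    have yq: "y ! q = \<beta> ! q" if "q \<noteq> 1" for q using that by (simp add: y_def)
    show ?case
    proof (rule rectangle[OF tup W1 IH Wsig[of k] n01])
      fix q assume q: "q < n" "q \<noteq> 0"
      show "ap ((W k)[k := \<beta>]) ! q = ap (U (Suc k)) ! q"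
        using q xq[of q] by (simp add: Wk cols(1) replicate_append_same[symmetric])
    next
      fix q assume q: "q < n" "q \<noteq> 1"
      show "ap (U k) ! q = ap (U (Suc k)) ! q"
        using q yq[of q] k by (simp add: cols(1) flip: replicate_add replicate_Suc)
    next
      fix q assume q: "q < n" "q \<noteq> 0" "q \<noteq> 1"
      show "ap (W k) ! q = ap (U (Suc k)) ! q"
        using q yq[of q] xq[of q] k by (simp add: cols flip: replicate_add replicate_Suc)
    next
      show "ap (W k) ! 0 = ap ((W k)[k := \<beta>]) ! 0"
        using n01 yq[of 0] by (simp add: Wk cols(2) eqm)
      show "ap (W k) ! 1 = ap (U k) ! 1" using n01 xq[of 1] by (simp add: cols)
    qed (use k in auto)
  qed
  from this[of m] have "ap (replicate m \<beta>) \<in> \<sigma>" by (simp add: U_def)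
  moreover have "ap (replicate m \<beta>) = \<beta>"
    using D_tuples[OF be(1)] by (intro nth_equalityI) (auto simp: F_idem mem_tuples_iff)
  ultimately show False using be by simp
qed

section \<open>Uniqueness of members of \<sigma> on lines of the block\<close>

lemma not_kill:
  assumes s: "s \<in> Q"
  obtains \<beta> where "\<beta> \<in> D" "\<beta> \<notin> \<sigma>" "ap ((replicate m s)[0 := \<beta>]) \<notin> \<sigma>"
proof -
  have "\<not> good (replicate m s)" using not_all_good good_all[OF s] by blast
  then obtain p \<beta> where p: "p < m" "\<beta> \<in> D" "ap ((replicate m s)[p := \<beta>]) \<notin> \<sigma>" by (auto simp: good_def)
  \<comment> \<open>The slot \<open>p\<close> of the failure is arbitrary, but all other arguments
    equal \<open>s\<close>, so the WNU identity carries it to slot 0.\<close>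
  have "ap ((replicate m s)[p := \<beta>]) = ap ((replicate m s)[0 := \<beta>])"
  proof (rule nth_equalityI)
    fix q assume "q < length (ap ((replicate m s)[p := \<beta>]))"
    hence q: "q < n" by simp
    have "s ! q \<in> A" "\<beta> ! q \<in> A" using D_tuples[OF p(2)] D_tuples[of s] s q by (auto simp: mem_tuples_iff)
    from F_wnu[OF q this p(1)] show "ap ((replicate m s)[p := \<beta>]) ! q = ap ((replicate m s)[0 := \<beta>]) ! q"
      using q by (simp add: map_update)
  qed simp
  hence nk: "ap ((replicate m s)[0 := \<beta>]) \<notin> \<sigma>" using p by simp
  moreover have "\<beta> \<notin> \<sigma>"
  proof
    assume "\<beta> \<in> \<sigma>"
    hence "ap ((replicate m s)[0 := \<beta>]) \<in> \<sigma>" using s m2 by (intro ap_update_sig) auto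
    thus False using nk by blast
  qed
  ultimately show ?thesis using that p by blast
qed

text \<open>With \<open>s = x[i := c]\<close> the WNU identity gives
  \<open>f(y[i := d], s, \<dots>, s) = f(y[i := c], x[i := d], s, \<dots>, s) \<in> \<sigma>\<close>, although \<open>y\<close> may lie outside the block.\<close>

lemma line_swap:
  assumes i: "i < n" and x: "x \<in> D" and c: "c \<in> As i" and d: "d \<in> As i"
    and xc: "x[i := c] \<in> \<sigma>" and xd: "x[i := d] \<in> \<sigma>"
    and y: "y[i := c] \<in> \<sigma>"
  shows "y[i := d] \<in> \<sigma>"
proof -
  define s where "s = x[i := c]"
  have s: "s \<in> Q" using xc x c D_update by (simp add: s_def)
  obtain \<beta> where be: "\<beta> \<in> D" "ap ((replicate m s)[0 := \<beta>]) \<notin> \<sigma>" using not_kill[OF s] by blast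
  have yl: "length y = n" using sig_length[OF y] by simp
  have m01: "0 < m" "1 < m" using m2 by auto
  have ydB: "y[i := d] \<in> prod_set n B"
  proof -
    have "y[i := c] \<in> prod_set n B" using y sig_sub by blast
    moreover have "d \<in> B i" using As_B[OF i] d by blast
    ultimately have "y[i := c, i := d] \<in> prod_set n B" using prod_set_update[of "y[i := c]"] by blast
    thus ?thesis by simp
  qed
  \<comment> \<open>In coordinate \<open>i\<close> there is one \<open>d\<close> among copies of
    \<open>c\<close>, and the WNU identity shifts it to slot 1. In the other coordinates
    \<open>x\<close> agrees with \<open>s\<close>, so inserting it changes nothing.\<close>
  have "ap ((replicate m s)[0 := y[i := d]]) = ap ((replicate m s)[0 := y[i := c], 1 := x[i := d]])"
  proof (rule nth_equalityI)
    fix q assume "q < length (ap ((replicate m s)[0 := y[i := d]]))"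
    hence q: "q < n" by simp
    show "ap ((replicate m s)[0 := y[i := d]]) ! q = ap ((replicate m s)[0 := y[i := c], 1 := x[i := d]]) ! q"
    proof (cases "q = i")
      case True
      have "(replicate m c)[0 := c] = replicate m c" by (intro nth_equalityI) (auto simp: nth_list_update)
      moreover have "F i ((replicate m c)[1 := d]) = F i ((replicate m c)[0 := d])"
        using F_wnu[OF i _ _ m01(2)] c d As_A[OF i] by blast
      ultimately show ?thesis using True q yl D_length[OF x] by (simp add: map_update s_def)
    next
      case False
      have "(replicate m (x ! q))[0 := y ! q, 1 := x ! q] = (replicate m (x ! q))[0 := y ! q]"
        using m01 by (intro nth_equalityI) (auto simp: nth_list_update)
      thus ?thesis using False q by (simp add: map_update s_def)
    qed
  qed simp
  also have "\<dots> \<in> \<sigma>"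
    using s y xd m01 by (intro ap_sig) (auto simp: set_conv_nth nth_list_update)
  finally have "ap ((replicate m s)[0 := y[i := d]]) \<in> \<sigma>" .
  thus ?thesis using poly_reflects[OF _ m01(1) _ be ydB] s by simp
qed

text \<open>Collapsing \<open>c\<close> to \<open>d\<close> in coordinate \<open>i\<close> preserves
  \<sigma> by \<open>line_swap\<close>, and the swap in the opposite direction keeps \<beta> outside
  \<sigma>. The dichotomy forces this collapse to be injective.\<close>

lemma line_unique:
  assumes i: "i < n" and x: "x \<in> D" and c: "c \<in> As i" and d: "d \<in> As i"
    and xc: "x[i := c] \<in> \<sigma>" and xd: "x[i := d] \<in> \<sigma>"
  shows "c = d"
proof -
  define \<Theta> where "\<Theta> = (\<lambda>j v. if j = i \<and> v = c then d else v)"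
  have va: "vapply \<Theta> y = (if y ! i = c then y[i := d] else y)" if "length y = n" for y
    using that i by (intro nth_equalityI) (auto simp: \<Theta>_def nth_list_update)
  have u: "uvf A n \<Theta>" using d As_A[OF i] by (auto simp: uvf_def \<Theta>_def)
  have p: "preserves \<Theta> \<sigma>"
    unfolding preserves_def using va sig_length line_swap[OF assms] by (metis list_update_id)
  obtain \<beta> where be: "K \<beta>" "\<beta> \<notin> \<sigma>" "\<beta> \<in> D" using D_nonmember by blast
  have "vapply \<Theta> \<beta> \<notin> \<sigma>"
    using va[OF D_length[OF be(3)]] be(2) line_swap[OF i x d c xd xc, of \<beta>] by (metis list_update_id)
  hence "inj_on (\<Theta> i) (B i)" using inj_on_if_not_kill[OF be(1) u p _ i] by blast
  moreover have "\<Theta> i c = \<Theta> i d" by (simp add: \<Theta>_def)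
  ultimately show ?thesis using c d As_B[OF i] by (meson inj_onD subsetD)
qed

end

section \<open>The group structure of a key block\<close>

lemma nth_take_drop:
  assumes "length x = length y" "i < length x" "k \<le> length x"
  shows "(take k x @ drop k y) ! i = (if i < k then x ! i else y ! i)"
  using assms by (auto simp: nth_append)

locale pointed_wnu_block = wnu_block +
  fixes e :: "'a list"
  assumes e: "e \<in> Q"
begin

lemma eD: "e \<in> D" and e_sig: "e \<in> \<sigma>" and length_e [simp]: "length e = n"
  using e D_length by auto

lemma n0: "0 < n" "1 < n" "2 < n" using n3 by auto

lemma m0: "0 < m" "1 < m" using m2 by auto

lemma e_As: "j < n \<Longrightarrow> e ! j \<in> As j" using eD by (simp add: mem_prod_set_iff)

lemma fin_As: "j < n \<Longrightarrow> finite (As j)" using As_A fin finite_subset by blast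

section \<open>Solving for coordinate 0\<close>

definition sol :: "'a list \<Rightarrow> 'a" where
  "sol x = (THE c. c \<in> As 0 \<and> x[0 := c] \<in> \<sigma>)"

lemma sol_eq:
  assumes x: "x \<in> D" and c: "c \<in> As 0" "x[0 := c] \<in> \<sigma>"
  shows "sol x = c"
  unfolding sol_def using c line_unique[OF n0(1) x] by blast

lemma sol:
  assumes x: "x \<in> D"
  shows sol_As: "sol x \<in> As 0" and sol_sig: "x[0 := sol x] \<in> \<sigma>"
proof -
  obtain c where c: "c \<in> As 0" "x[0 := c] \<in> \<sigma>" using line[OF x n0(1)] .
  thus "sol x \<in> As 0" "x[0 := sol x] \<in> \<sigma>" using sol_eq[OF x c] by simp_all
qed

lemma sol_update_0: "sol (x[0 := c]) = sol x"
  by (simp add: sol_def)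

lemma sol_e: "sol e = e ! 0"
  using e_sig by (intro sol_eq[OF eD]) (simp_all add: e_As n0)

lemma sig_iff_sol: "x \<in> D \<Longrightarrow> x \<in> \<sigma> \<longleftrightarrow> x ! 0 = sol x"
  using sol_eq[of x "x ! 0"] sol_sig[of x] n0 by (metis list_update_id mem_prod_set_iff)

lemma ap_D': "length vs = m \<Longrightarrow> set vs \<subseteq> D \<Longrightarrow> ap vs \<in> D"
  unfolding mem_prod_set_iff[of "ap vs"] by (auto intro!: F_closed simp: mem_prod_set_iff subset_iff)

text \<open>\<sigma> is closed under \<open>ap\<close>, and uniqueness on lines identifies the value
  in coordinate 0.\<close>

lemma sol_ap:
  assumes vs: "length vs = m" "set vs \<subseteq> D"
  shows "sol (ap vs) = F 0 (map sol vs)"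
proof (rule sol_eq[OF ap_D'[OF vs]])
  show "F 0 (map sol vs) \<in> As 0" using vs sol_As by (intro F_closed[OF n0(1)]) auto
  define ws where "ws = map (\<lambda>v. v[0 := sol v]) vs"
  have "ap ws \<in> \<sigma>" using vs sol_sig by (intro ap_sig) (auto simp: ws_def)
  moreover have "ap ws = (ap vs)[0 := F 0 (map sol vs)]"
  proof (rule nth_equalityI)
    fix q assume "q < length (ap ws)"
    hence q: "q < n" by simp
    show "ap ws ! q = (ap vs)[0 := F 0 (map sol vs)] ! q"
    proof (cases "q = 0")
      case True
      have "map (\<lambda>t. t ! 0) ws = map sol vs" using vs D_length n0 by (auto simp: ws_def)
      thus ?thesis using True n0 by simp
    next
      case False
      hence "map (\<lambda>t. t ! q) ws = map (\<lambda>t. t ! q) vs" by (simp add: ws_def)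
      thus ?thesis using False q by simp
    qed
  qed simp
  ultimately show "(ap vs)[0 := F 0 (map sol vs)] \<in> \<sigma>" by simp
qed

text \<open>Transports coordinate \<open>j\<close> to coordinate 0 with all others held at the base
  point, so that every coordinate shares the carrier \<open>As 0\<close>.\<close>

definition \<pi> :: "nat \<Rightarrow> 'a \<Rightarrow> 'a" where "\<pi> j b = sol (e[j := b])"

lemma pi_bij:
  assumes j: "j < n" "j \<noteq> 0"
  shows "bij_betw (\<pi> j) (As j) (As 0)"
  unfolding bij_betw_def
proof
  have D1: "e[j := b] \<in> D" if "b \<in> As j" for b using D_update eD that by blast
  have sig: "e[0 := \<pi> j b, j := b] \<in> \<sigma>" if "b \<in> As j" for b
    using sol_sig[OF D1[OF that]] j by (simp add: \<pi>_def list_update_swap)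
  have cl: "\<pi> j b \<in> As 0" if "b \<in> As j" for b using sol_As[OF D1[OF that]] by (simp add: \<pi>_def)
  show "inj_on (\<pi> j) (As j)"
  proof (rule inj_onI)
    fix b b' assume b: "b \<in> As j" "b' \<in> As j" "\<pi> j b = \<pi> j b'"
    have "e[0 := \<pi> j b] \<in> D" using D_update eD cl b by blast
    thus "b = b'" using line_unique[OF j(1) _ b(1,2)] sig b by metis
  qed
  show "\<pi> j ` As j = As 0"
  proof
    show "\<pi> j ` As j \<subseteq> As 0" using cl by blast
    show "As 0 \<subseteq> \<pi> j ` As j"
    proof
      fix c assume c: "c \<in> As 0"
      have "e[0 := c] \<in> D" using D_update eD c by blast
      then obtain b where b: "b \<in> As j" "e[0 := c, j := b] \<in> \<sigma>" using line[OF _ j(1)] by metis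
      have "\<pi> j b = c" unfolding \<pi>_def using b c j D1 by (intro sol_eq) (auto simp: list_update_swap)
      thus "c \<in> \<pi> j ` As j" using b by blast
    qed
  qed
qed

lemma pi_e: "\<pi> j (e ! j) = e ! 0" by (simp add: \<pi>_def sol_e)

lemma pi_F:
  assumes j: "j < n" "j \<noteq> 0" and xs: "length xs = m" "set xs \<subseteq> As j"
  shows "\<pi> j (F j xs) = F 0 (map (\<pi> j) xs)"
proof -
  define vs where "vs = map (\<lambda>b. e[j := b]) xs"
  have vs: "length vs = m" "set vs \<subseteq> D" using xs D_update eD by (auto simp: vs_def)
  have "ap vs = e[j := F j xs]"
  proof (rule nth_equalityI)
    fix q assume "q < length (ap vs)"
    hence q: "q < n" by simp
    show "ap vs ! q = e[j := F j xs] ! q"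
    proof (cases "q = j")
      case True
      have "map (\<lambda>t. t ! j) vs = xs" using j by (simp add: vs_def comp_def)
      thus ?thesis using True j by simp
    next
      case False
      hence "map (\<lambda>t. t ! q) vs = replicate m (e ! q)" using xs by (simp add: vs_def comp_def map_replicate_const)
      thus ?thesis using False q e_As[OF q] As_A[OF q] F_idem[OF q] by (simp add: subset_iff)
    qed
  qed simp
  thus ?thesis using sol_ap[OF vs] by (simp add: \<pi>_def[abs_def] vs_def comp_def)
qed

definition iv :: "nat \<Rightarrow> 'a \<Rightarrow> 'a" where "iv j = inv_into (As j) (\<pi> j)"

lemma iv:
  assumes "j < n" "j \<noteq> 0" "a \<in> As 0"
  shows iv_As: "iv j a \<in> As j" and pi_iv: "\<pi> j (iv j a) = a"
  using pi_bij[OF assms(1,2)] assms(3) unfolding iv_def bij_betw_def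
  by (auto intro: inv_into_into f_inv_into_f)

lemma iv_pi: "j < n \<Longrightarrow> j \<noteq> 0 \<Longrightarrow> b \<in> As j \<Longrightarrow> iv j (\<pi> j b) = b"
  using pi_bij[of j] unfolding iv_def bij_betw_def by (simp add: inv_into_f_f)

lemma iv_F:
  assumes j: "j < n" "j \<noteq> 0" and xs: "length xs = m" "set xs \<subseteq> As 0"
  shows "iv j (F 0 xs) = F j (map (iv j) xs)"
proof -
  have m: "set (map (iv j) xs) \<subseteq> As j" using iv_As[OF j] xs by auto
  have "map (\<pi> j \<circ> iv j) xs = xs" using pi_iv[OF j] xs by (intro map_idI) auto
  hence "\<pi> j (F j (map (iv j) xs)) = F 0 xs" using pi_F[OF j _ m] xs by simp
  thus ?thesis using iv_pi[OF j, of "F j (map (iv j) xs)"] F_closed[OF j(1) _ m] xs by simp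
qed

text \<open>A principal isotope of the quasigroup in coordinates 0, 1, 2, with the others at the
  base point; the twists by \<open>iv\<close> make \<open>e ! 0\<close> neutral.\<close>

definition plus :: "'a \<Rightarrow> 'a \<Rightarrow> 'a" where
  "plus a b = sol (e[1 := iv 1 a, 2 := iv 2 b])"

lemma plus_D: "a \<in> As 0 \<Longrightarrow> b \<in> As 0 \<Longrightarrow> e[1 := iv 1 a, 2 := iv 2 b] \<in> D"
  using D_update eD iv_As n0 by simp

lemma plus_closed: "a \<in> As 0 \<Longrightarrow> b \<in> As 0 \<Longrightarrow> plus a b \<in> As 0"
  unfolding plus_def using sol_As[OF plus_D] by blast

lemma plus_zero: "a \<in> As 0 \<Longrightarrow> plus a (e ! 0) = a" "a \<in> As 0 \<Longrightarrow> plus (e ! 0) a = a"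
proof -
  assume a: "a \<in> As 0"
  have 1: "iv j (e ! 0) = e ! j" if "j < n" "j \<noteq> 0" for j using iv_pi[OF that e_As[OF that(1)]] pi_e[of j] by simp
  have "e[1 := iv 1 a, 2 := e ! 2] = e[1 := iv 1 a]"
    using n0 by (intro nth_equalityI) (auto simp: nth_list_update)
  thus "plus a (e ! 0) = a" using 1[of 2] pi_iv[of 1 a] a n0 by (simp add: plus_def \<pi>_def)
  show "plus (e ! 0) a = a" using 1[of 1] pi_iv[of 2 a] a n0 by (simp add: plus_def \<pi>_def)
qed

text \<open>The WNU commutes with \<open>sol\<close> and with the identifications \<open>iv\<close>,
  and by idempotence it fixes the constant entries of \<open>e\<close>; hence it is a homomorphism
  of the loop.\<close>

lemma plus_F:
  assumes xs: "length xs = m" "set xs \<subseteq> As 0" and ys: "length ys = m" "set ys \<subseteq> As 0"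
  shows "F 0 (map2 plus xs ys) = plus (F 0 xs) (F 0 ys)"
proof -
  define vs where "vs = map2 (\<lambda>a b. e[1 := iv 1 a, 2 := iv 2 b]) xs ys"
  have vs: "length vs = m" "set vs \<subseteq> D"
  proof -
    show "length vs = m" using xs ys by (simp add: vs_def)
    moreover have "vs ! k \<in> D" if "k < m" for k
    proof -
      have "xs ! k \<in> As 0" "ys ! k \<in> As 0" using that xs ys by auto
      thus ?thesis using plus_D that xs ys by (simp add: vs_def)
    qed
    ultimately show "set vs \<subseteq> D" by (auto simp: set_conv_nth)
  qed
  have "ap vs = e[1 := F 1 (map (iv 1) xs), 2 := F 2 (map (iv 2) ys)]"
  proof (rule nth_equalityI)
    fix q assume "q < length (ap vs)"
    hence q: "q < n" by simp
    show "ap vs ! q = e[1 := F 1 (map (iv 1) xs), 2 := F 2 (map (iv 2) ys)] ! q"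
    proof (cases "q = 1 \<or> q = 2")
      case True
      have "map (\<lambda>t. t ! 1) vs = map (iv 1) xs" "map (\<lambda>t. t ! 2) vs = map (iv 2) ys"
        using n0 xs ys by (auto simp: vs_def intro!: nth_equalityI)
      thus ?thesis using True n0 by auto
    next
      case False
      hence "map (\<lambda>t. t ! q) vs = replicate m (e ! q)"
        using xs ys by (auto simp: vs_def intro!: nth_equalityI)
      thus ?thesis using False q e_As[OF q] As_A[OF q] F_idem[OF q] by (simp add: subset_iff)
    qed
  qed simp
  moreover have "iv 1 (F 0 xs) = F 1 (map (iv 1) xs)" "iv 2 (F 0 ys) = F 2 (map (iv 2) ys)"
    using iv_F n0 xs ys by auto
  moreover have "map sol vs = map2 plus xs ys" by (simp add: vs_def plus_def split_def comp_def)
  ultimately show ?thesis using sol_ap[OF vs] by (simp add: plus_def)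
qed

text \<open>The common coefficient of the WNU: arguments contribute their values under
  \<open>h\<close>, as \<open>F_two\<close> shows for two of them.\<close>

definition h :: "nat \<Rightarrow> 'a \<Rightarrow> 'a" where "h j a = F j ((replicate m (e ! j))[0 := a])"

lemma rep_set: "j < n \<Longrightarrow> a \<in> As j \<Longrightarrow> set ((replicate m (e ! j))[k := a]) \<subseteq> As j"
  using e_As set_update_subset_insert[of "replicate m (e ! j)" k a] by (auto simp: set_replicate_conv_if split: if_splits)

lemma rep_set2: "j < n \<Longrightarrow> a \<in> As j \<Longrightarrow> b \<in> As j \<Longrightarrow> set ((replicate m (e ! j))[k := a, l := b]) \<subseteq> As j"
  using rep_set[of j a k] set_update_subset_insert[of "(replicate m (e ! j))[k := a]" l b] by auto

lemma h_closed: "j < n \<Longrightarrow> a \<in> As j \<Longrightarrow> h j a \<in> As j"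
  unfolding h_def by (intro F_closed rep_set) auto

lemma h_pos: "j < n \<Longrightarrow> a \<in> As j \<Longrightarrow> k < m \<Longrightarrow> F j ((replicate m (e ! j))[k := a]) = h j a"
  unfolding h_def using F_wnu[of j "e ! j" a k] e_As[of j] As_A[of j] by auto

lemma h_e: "j < n \<Longrightarrow> h j (e ! j) = e ! j"
proof -
  assume j: "j < n"
  have "(replicate m (e ! j))[0 := e ! j] = replicate m (e ! j)" by (intro nth_equalityI) (auto simp: nth_list_update)
  thus ?thesis unfolding h_def using F_idem[OF j] e_As[OF j] As_A[OF j] by auto
qed

text \<open>By \<open>not_kill\<close> the polynomial \<open>h\<close> leaves some key tuple outside
  \<sigma>, so it is injective, and it permutes the finite \<open>As j\<close>.\<close>

lemma h_bij:
  assumes j: "j < n"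
  shows "bij_betw (h j) (As j) (As j)"
proof -
  obtain \<beta> where be: "\<beta> \<in> D" "ap ((replicate m e)[0 := \<beta>]) \<notin> \<sigma>" using not_kill[OF e] by blast
  have "inj_on (\<lambda>v. F j ((map (\<lambda>t. t ! j) (replicate m e))[0 := v])) (B j)"
    using e_sig m0 by (intro poly_inj[OF _ _ _ be j]) auto
  hence "inj_on (h j) (B j)" by (simp add: h_def[abs_def])
  hence inj: "inj_on (h j) (As j)" using As_B[OF j] by (rule inj_on_subset)
  have "h j ` As j = As j" using inj h_closed[OF j] by (intro endo_inj_surj fin_As j) auto
  thus ?thesis using inj by (simp add: bij_betw_def)
qed

lemma map2_eqI:
  assumes "length xs = m" "length ys = m" "length zs = m"
    and "\<And>i. i < m \<Longrightarrow> f (xs ! i) (ys ! i) = zs ! i"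
  shows "map2 f xs ys = zs"
  using assms by (intro nth_equalityI) auto

lemma F_two:
  assumes a: "a \<in> As 0" and b: "b \<in> As 0"
  shows "F 0 ((replicate m (e ! 0))[0 := a, 1 := b]) = plus (h 0 a) (h 0 b)"
proof -
  have "map2 plus ((replicate m (e ! 0))[0 := a]) ((replicate m (e ! 0))[1 := b]) = (replicate m (e ! 0))[0 := a, 1 := b]"
    using a b e_As[OF n0(1)] by (intro map2_eqI) (auto simp: nth_list_update plus_zero)
  hence "F 0 ((replicate m (e ! 0))[0 := a, 1 := b]) = plus (F 0 ((replicate m (e ! 0))[0 := a])) (F 0 ((replicate m (e ! 0))[1 := b]))"
    using plus_F[OF _ rep_set[OF n0(1) a] _ rep_set[OF n0(1) b], of 0 1] by simp
  thus ?thesis using h_pos[OF n0(1) b m0(2)] by (simp add: h_def)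
qed

lemma h_plus:
  assumes a: "a \<in> As 0" and b: "b \<in> As 0"
  shows "h 0 (plus a b) = plus (h 0 a) (h 0 b)"
proof -
  have "map2 plus ((replicate m (e ! 0))[0 := a]) ((replicate m (e ! 0))[0 := b]) = (replicate m (e ! 0))[0 := plus a b]"
    using a b e_As[OF n0(1)] by (intro map2_eqI) (auto simp: nth_list_update plus_zero)
  thus ?thesis
    using plus_F[OF _ rep_set[OF n0(1) a] _ rep_set[OF n0(1) b], of 0 0] by (simp add: h_def)
qed

text \<open>The homomorphism law for the arguments \<open>a', b'\<close> and \<open>c', d'\<close>,
  padded by the neutral element, is the medial law for values of \<open>h\<close>; every element is
  such a value.\<close>

lemma medial:
  assumes "a \<in> As 0" "b \<in> As 0" "c \<in> As 0" "d \<in> As 0"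
  shows "plus (plus a b) (plus c d) = plus (plus a c) (plus b d)"
proof -
  have surj: "\<exists>a'\<in>As 0. h 0 a' = a" if "a \<in> As 0" for a
    using h_bij[OF n0(1)] that by (metis bij_betw_imp_surj_on imageE)
  obtain a' b' c' d' where
    p: "a' \<in> As 0" "h 0 a' = a" "b' \<in> As 0" "h 0 b' = b" "c' \<in> As 0" "h 0 c' = c" "d' \<in> As 0" "h 0 d' = d"
    using surj assms by metis
  have "map2 plus ((replicate m (e ! 0))[0 := a', 1 := b']) ((replicate m (e ! 0))[0 := c', 1 := d'])
      = (replicate m (e ! 0))[0 := plus a' c', 1 := plus b' d']"
    using p e_As[OF n0(1)] m0 by (intro map2_eqI) (auto simp: nth_list_update plus_zero)
  hence "F 0 ((replicate m (e ! 0))[0 := plus a' c', 1 := plus b' d']) =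
     plus (F 0 ((replicate m (e ! 0))[0 := a', 1 := b'])) (F 0 ((replicate m (e ! 0))[0 := c', 1 := d']))"
    using plus_F[OF _ rep_set2[OF n0(1) p(1) p(3)] _ rep_set2[OF n0(1) p(5) p(7)], of 0 1 0 1] by simp
  hence "plus (h 0 (plus a' c')) (h 0 (plus b' d')) = plus (plus (h 0 a') (h 0 b')) (plus (h 0 c') (h 0 d'))"
    unfolding F_two[OF p(1,3)] F_two[OF p(5,7)] F_two[OF plus_closed[OF p(1,5)] plus_closed[OF p(3,7)]] .
  thus ?thesis using p by (simp add: h_plus)
qed

definition G :: "'a monoid" where "G = \<lparr>carrier = As 0, monoid.mult = plus, one = e ! 0\<rparr>"

lemma G_simps [simp]: "carrier G = As 0" "monoid.mult G = plus" "one G = e ! 0"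
  by (simp_all add: G_def)

text \<open>A medial operation with a neutral element is associative and commutative
  (Eckmann-Hilton). A left inverse is read off a member of \<sigma> on a line in direction
  1.\<close>

lemma comm_group_G: "comm_group G"
proof (rule comm_groupI)
  note e0 = e_As[OF n0(1)]
  fix x y z assume x: "x \<in> carrier G" and y: "y \<in> carrier G" and z: "z \<in> carrier G"
  show "x \<otimes>\<^bsub>G\<^esub> y \<otimes>\<^bsub>G\<^esub> z = x \<otimes>\<^bsub>G\<^esub> (y \<otimes>\<^bsub>G\<^esub> z)"
    using medial[of x y "e ! 0" z] x y z e0 by (simp add: plus_zero)
next
  note e0 = e_As[OF n0(1)]
  fix x y assume x: "x \<in> carrier G" and y: "y \<in> carrier G"
  show "x \<otimes>\<^bsub>G\<^esub> y = y \<otimes>\<^bsub>G\<^esub> x"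
    using medial[of "e ! 0" x y "e ! 0"] x y e0 by (simp add: plus_zero)
  show "x \<otimes>\<^bsub>G\<^esub> y \<in> carrier G" using x y plus_closed by simp
next
  fix x assume x: "x \<in> carrier G"
  show "\<one>\<^bsub>G\<^esub> \<otimes>\<^bsub>G\<^esub> x = x" using x by (simp add: plus_zero)
  have x0: "x \<in> As 0" using x by simp
  have "e[2 := iv 2 x] \<in> D" using D_update eD iv_As x0 n0 by simp
  hence "e[2 := iv 2 x, 0 := e ! 0] \<in> D" using D_update e_As[OF n0(1)] by blast
  then obtain b where b: "b \<in> As 1" "e[2 := iv 2 x, 0 := e ! 0, 1 := b] \<in> \<sigma>" using line[OF _ n0(2)] by metis
  have ii: "iv 1 (\<pi> 1 b) = b" using iv_pi b n0 by simp
  have pb: "\<pi> 1 b \<in> As 0" using pi_bij[of 1] n0 b by (auto simp: bij_betw_def)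
  have "e[2 := iv 2 x, 0 := e ! 0, 1 := b] = e[1 := b, 2 := iv 2 x, 0 := e ! 0]"
    by (intro nth_equalityI) (auto simp: nth_list_update)
  hence "plus (\<pi> 1 b) x = e ! 0"
    unfolding plus_def ii using b e_As[OF n0(1)] plus_D[OF pb x0] ii by (intro sol_eq) auto
  thus "\<exists>y\<in>carrier G. y \<otimes>\<^bsub>G\<^esub> x = \<one>\<^bsub>G\<^esub>" using pb by auto
qed (simp add: e_As n0)

sublocale G: comm_group G by (rule comm_group_G)

section \<open>The solution map as a sum over the coordinates\<close>

lemma sol_split:
  assumes x: "x \<in> D" and t: "t < n" "t \<noteq> 0"
  shows "sol x = plus (sol (x[t := e ! t])) (\<pi> t (x ! t))"
proof -
  \<comment> \<open>\<open>y\<close> is the coordinatewise preimage of \<open>x\<close> under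
    \<open>h\<close>. It is split into its part \<open>v\<close> away from \<open>t\<close> and its
    part \<open>v'\<close> at \<open>t\<close>; the WNU with these in two slots and \<open>e\<close>
    in the others recombines them to \<open>x\<close>.\<close>
  define y where "y = map (\<lambda>j. inv_into (As j) (h j) (x ! j)) [0..<n]"
  have xl: "length x = n" using D_length x by blast
  have yn: "y ! j \<in> As j" "h j (y ! j) = x ! j" if j: "j < n" for j
  proof -
    have "x ! j \<in> h j ` As j" using x j h_bij[OF j] by (auto simp: mem_prod_set_iff bij_betw_def)
    thus "y ! j \<in> As j" "h j (y ! j) = x ! j" using j by (auto simp: y_def inv_into_into f_inv_into_f)
  qed
  have yD: "y \<in> D" using yn by (auto simp: mem_prod_set_iff y_def)
  define v where "v = y[t := e ! t]"
  define v' where "v' = e[t := y ! t]"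
  have vD: "v \<in> D" "v' \<in> D" using yD eD D_update e_As[OF t(1)] yn(1)[OF t(1)] by (auto simp: v_def v'_def)
  have yl: "length y = n" by (simp add: y_def)
  have rr: "(replicate m z)[k := z] = replicate m z" for z :: 'a and k
    by (cases "k < m") (auto intro!: nth_equalityI simp: nth_list_update)
  have ss: "set ((replicate m e)[0 := v, 1 := v']) \<subseteq> D" "set ((replicate m e)[0 := v]) \<subseteq> D" "set ((replicate m e)[1 := v']) \<subseteq> D"
    using vD eD m0 by (auto simp: set_conv_nth nth_list_update)
  have 1: "ap ((replicate m e)[0 := v, 1 := v']) = x"
  proof (rule nth_equalityI)
    fix q assume "q < length (ap ((replicate m e)[0 := v, 1 := v']))"
    hence q: "q < n" by simp
    show "ap ((replicate m e)[0 := v, 1 := v']) ! q = x ! q"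
    proof (cases "q = t")
      case True
      thus ?thesis using q yl h_pos[OF q yn(1)[OF q] m0(2)] yn(2)[OF q] by (simp add: map_update v_def v'_def rr)
    next
      case False
      have "(replicate m (e ! q))[0 := y ! q, 1 := e ! q] = (replicate m (e ! q))[0 := y ! q]"
        using m0 by (intro nth_equalityI) (auto simp: nth_list_update)
      thus ?thesis using False q yn(2)[OF q] by (simp add: map_update v_def v'_def h_def)
    qed
  qed (simp add: xl)
  have 2: "ap ((replicate m e)[0 := v]) = x[t := e ! t]"
  proof (rule nth_equalityI)
    fix q assume "q < length (ap ((replicate m e)[0 := v]))"
    hence q: "q < n" by simp
    show "ap ((replicate m e)[0 := v]) ! q = x[t := e ! t] ! q"
      using h_e[OF q] yn(2)[OF q] yl xl q by (cases "q = t") (auto simp: map_update v_def h_def)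
  qed (simp add: xl)
  have 3: "ap ((replicate m e)[1 := v']) = e[t := x ! t]"
  proof (rule nth_equalityI)
    fix q assume "q < length (ap ((replicate m e)[1 := v']))"
    hence q: "q < n" by simp
    show "ap ((replicate m e)[1 := v']) ! q = e[t := x ! t] ! q"
      using h_pos[OF q e_As[OF q] m0(2)] h_e[OF q] h_pos[OF q yn(1)[OF q] m0(2)] yn(2)[OF q] yl xl q
      by (cases "q = t") (auto simp: map_update v'_def)
  qed simp
  have s: "sol v \<in> As 0" "sol v' \<in> As 0" using sol_As vD by auto
  have "sol x = F 0 ((replicate m (e ! 0))[0 := sol v, 1 := sol v'])"
    using sol_ap[OF _ ss(1)] 1 by (simp add: map_update sol_e)
  also have "\<dots> = plus (h 0 (sol v)) (h 0 (sol v'))" by (rule F_two[OF s])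
  also have "h 0 (sol v) = sol (x[t := e ! t])"
    using sol_ap[OF _ ss(2)] 2 by (simp add: map_update sol_e h_def)
  also have "h 0 (sol v') = \<pi> t (x ! t)"
    using sol_ap[OF _ ss(3)] 3 h_pos[OF n0(1) s(2) m0(2)] by (simp add: map_update sol_e \<pi>_def)
  finally show ?thesis .
qed

lemma pi_closed: "j < n \<Longrightarrow> j \<noteq> 0 \<Longrightarrow> b \<in> As j \<Longrightarrow> \<pi> j b \<in> As 0"
  using pi_bij[of j] by (auto simp: bij_betw_def)

text \<open>Hybrids of \<open>x\<close> and \<open>e\<close> gain one entry of \<open>x\<close> at a
  time by \<open>sol_split\<close>. Entry 0 does not influence \<open>sol\<close>, so the product
  starts at 1.\<close>

lemma sol_finprod:
  assumes x: "x \<in> D"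
  shows "sol x = finprod G (\<lambda>j. \<pi> j (x ! j)) {1..<n}"
proof -
  have xl: "length x = n" using D_length x by blast
  have xj: "x ! j \<in> As j" if "j < n" for j using x that by (simp add: mem_prod_set_iff)
  have "Suc t \<le> n \<Longrightarrow> sol (take (Suc t) x @ drop (Suc t) e) = finprod G (\<lambda>j. \<pi> j (x ! j)) {1..<Suc t}" for t
  proof (induction t)
    case 0
    have "take (Suc 0) x @ drop (Suc 0) e = e[0 := x ! 0]"
      using xl n0 by (intro nth_equalityI) (auto simp: nth_append nth_list_update)
    thus ?case using sol_update_0 sol_e by simp
  next
    case (Suc t)
    let ?z = "take (Suc (Suc t)) x @ drop (Suc (Suc t)) e"
    have t: "Suc t < n" using Suc by simp
    have "?z ! i \<in> As i" if "i < n" for i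
      using xj[OF that] e_As[OF that] xl t that by (simp add: nth_take_drop)
    hence zD: "?z \<in> D" using xl t by (simp add: mem_prod_set_iff)
    have z1: "?z[Suc t := e ! Suc t] = take (Suc t) x @ drop (Suc t) e"
    proof (rule nth_equalityI)
      fix i assume "i < length (?z[Suc t := e ! Suc t])"
      hence i: "i < n" using xl t by simp
      show "?z[Suc t := e ! Suc t] ! i = (take (Suc t) x @ drop (Suc t) e) ! i"
        using i t xl by (cases "i = Suc t") (auto simp: nth_take_drop)
    qed (use xl t in simp)
    have z2: "?z ! Suc t = x ! Suc t" using t xl by (simp add: nth_take_drop)
    have "sol ?z = plus (finprod G (\<lambda>j. \<pi> j (x ! j)) {1..<Suc t}) (\<pi> (Suc t) (x ! Suc t))"
      using sol_split[OF zD t] Suc z1 z2 by simp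
    also have "\<dots> = finprod G (\<lambda>j. \<pi> j (x ! j)) (insert (Suc t) {1..<Suc t})"
    proof -
      have pc: "(\<lambda>j. \<pi> j (x ! j)) \<in> {1..<Suc t} \<rightarrow> carrier G" "\<pi> (Suc t) (x ! Suc t) \<in> carrier G"
        using pi_closed xj t by auto
      have "finprod G (\<lambda>j. \<pi> j (x ! j)) (insert (Suc t) {1..<Suc t})
          = \<pi> (Suc t) (x ! Suc t) \<otimes>\<^bsub>G\<^esub> finprod G (\<lambda>j. \<pi> j (x ! j)) {1..<Suc t}"
        using pc by (intro G.finprod_insert) auto
      thus ?thesis using G.m_comm[OF pc(2) G.finprod_closed[OF pc(1)]] by simp
    qed
    also have "insert (Suc t) {1..<Suc t} = {1..<Suc (Suc t)}" by auto
    finally show ?case .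
  qed
  from this[of "n - 1"] show ?thesis using xl n0 by simp
qed

text \<open>Inverting coordinate 0 turns the equation \<open>x ! 0 = sol x\<close> into the
  triviality of a single product.\<close>

definition \<phi> :: "nat \<Rightarrow> 'a \<Rightarrow> 'a" where
  "\<phi> j = (if j = 0 then m_inv G else \<pi> j)"

lemma phi_bij: "j < n \<Longrightarrow> bij_betw (\<phi> j) (As j) (carrier G)"
proof (cases "j = 0")
  case True
  have "bij_betw (m_inv G) (carrier G) (carrier G)"
    by (rule bij_betwI[where g = "m_inv G"]) (auto simp del: G_simps)
  thus ?thesis using True by (simp add: \<phi>_def)
qed (simp add: \<phi>_def pi_bij)

lemma sig_iff_finprod:
  assumes x: "x \<in> D"
  shows "x \<in> \<sigma> \<longleftrightarrow> finprod G (\<lambda>j. \<phi> j (x ! j)) {..<n} = \<one>\<^bsub>G\<^esub>"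
proof -
  have xj: "x ! j \<in> As j" if "j < n" for j using x that by (simp add: mem_prod_set_iff)
  have pc: "(\<lambda>j. \<pi> j (x ! j)) \<in> {1..<n} \<rightarrow> carrier G" using pi_closed xj by auto
  have x0: "x ! 0 \<in> carrier G" using xj n0 by simp
  have sc: "sol x \<in> carrier G" using sol_As[OF x] by simp
  have "{..<n} = insert 0 {1..<n}" using n0 by auto
  hence "finprod G (\<lambda>j. \<phi> j (x ! j)) {..<n} = finprod G (\<lambda>j. \<phi> j (x ! j)) (insert 0 {1..<n})" by simp
  also have "\<dots> = \<phi> 0 (x ! 0) \<otimes>\<^bsub>G\<^esub> finprod G (\<lambda>j. \<phi> j (x ! j)) {1..<n}"
    using pc x0 by (intro G.finprod_insert) (auto simp: \<phi>_def simp del: G_simps)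
  also have "finprod G (\<lambda>j. \<phi> j (x ! j)) {1..<n} = finprod G (\<lambda>j. \<pi> j (x ! j)) {1..<n}"
    using pc by (intro G.finprod_cong') (auto simp: \<phi>_def)
  also have "\<dots> = sol x" using sol_finprod[OF x] by simp
  finally have eq: "finprod G (\<lambda>j. \<phi> j (x ! j)) {..<n} = inv\<^bsub>G\<^esub> (x ! 0) \<otimes>\<^bsub>G\<^esub> sol x" by (simp add: \<phi>_def)
  have "inv\<^bsub>G\<^esub> (x ! 0) \<otimes>\<^bsub>G\<^esub> sol x = \<one>\<^bsub>G\<^esub> \<longleftrightarrow> x ! 0 = sol x"
    using G.inv_solve_left[OF G.one_closed x0 sc] sc x0
    by (metis G.inv_comm G.inv_equality G.inv_inv G.inv_closed G.l_inv)
  thus ?thesis using sig_iff_sol[OF x] eq by simp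
qed

section \<open>Multiples as polynomials, torsion and the exponent\<close>

lemma h_pow_closed: "a \<in> As 0 \<Longrightarrow> (h 0 ^^ r) a \<in> As 0"
  by (induction r) (auto simp: h_closed n0)

lemma h_pow_plus: "a \<in> As 0 \<Longrightarrow> b \<in> As 0 \<Longrightarrow> (h 0 ^^ r) (plus a b) = plus ((h 0 ^^ r) a) ((h 0 ^^ r) b)"
  by (induction r) (auto simp: h_plus h_pow_closed)

lemma h_pow_e: "(h 0 ^^ r) (e ! 0) = e ! 0"
  by (induction r) (auto simp: h_e n0)

lemma h_pow_eq_e: "a \<in> As 0 \<Longrightarrow> (h 0 ^^ r) a = e ! 0 \<Longrightarrow> a = e ! 0"
proof (induction r)
  case (Suc r)
  have "h 0 ((h 0 ^^ r) a) = h 0 (e ! 0)" using Suc h_e n0 by simp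
  hence "(h 0 ^^ r) a = e ! 0"
    using h_bij[OF n0(1)] h_pow_closed[OF Suc.prems(1)] e_As[OF n0(1)] by (meson bij_betw_def inj_onD)
  thus ?case using Suc by simp
qed simp

lemma h_uvf: "uvf A n h" and h_preserves: "preserves h \<sigma>"
proof -
  have "h = (\<lambda>i v. F i ((map (\<lambda>t. t ! i) (replicate m e))[0 := v]))" by (simp add: h_def[abs_def])
  thus "uvf A n h" "preserves h \<sigma>"
    using poly_uvf[of "replicate m e" 0] poly_preserves[of "replicate m e" 0] e_sig m0 by auto
qed

text \<open>By \<open>F_two\<close>, addition is a polynomial only up to one application of
  \<open>h\<close>. Placing the map for \<open>r\<close> in one slot and the \<open>r\<close>-th
  iterate of \<open>h\<close> in the next keeps the powers of \<open>h\<close> on both summands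
  equal.\<close>

lemma multiple_polynomial:
  "\<exists>\<Theta>. uvf A n \<Theta> \<and> preserves \<Theta> \<sigma> \<and> (\<forall>j<n. \<Theta> j (e ! j) = e ! j) \<and>
     (\<forall>a\<in>As 0. \<Theta> 0 a = (h 0 ^^ r) (a [^]\<^bsub>G\<^esub> r))"
proof (induction r)
  case 0
  have "vapply (\<lambda>j v. e ! j) x = e" if "x \<in> \<sigma>" for x
    using sig_length[OF that] by (intro nth_equalityI) auto
  hence "preserves (\<lambda>j v. e ! j) \<sigma>" using e_sig by (simp add: preserves_def)
  moreover have "uvf A n (\<lambda>j v. e ! j)" using e_As As_A by (auto simp: uvf_def)
  ultimately show ?case by (intro exI[of _ "\<lambda>j v. e ! j"]) simp
next
  case (Suc r)
  then obtain \<Theta> where T: "uvf A n \<Theta>" "preserves \<Theta> \<sigma>" "\<And>j. j < n \<Longrightarrow> \<Theta> j (e ! j) = e ! j"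
    "\<And>a. a \<in> As 0 \<Longrightarrow> \<Theta> 0 a = (h 0 ^^ r) (a [^]\<^bsub>G\<^esub> r)" by blast
  define \<Theta>' where "\<Theta>' j v = F j ((replicate m (e ! j))[0 := \<Theta> j v, 1 := (h j ^^ r) v])" for j v
  have eA: "e ! j \<in> A" if "j < n" for j using that e_As As_A by blast
  have "uvf A n \<Theta>'"
    unfolding uvf_def \<Theta>'_def
  proof (intro allI impI ballI F_in)
    fix i v assume i: "i < n" and v: "v \<in> A"
    have "\<Theta> i v \<in> A" using T(1) i v by (simp add: uvf_def)
    moreover have "(h i ^^ r) v \<in> A" using uvf_pow[OF h_uvf i v] .
    ultimately show "(replicate m (e ! i))[0 := \<Theta> i v, 1 := (h i ^^ r) v] \<in> tuples A m"
      using eA[OF i] m0 by (auto simp: mem_tuples_iff nth_list_update)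
  qed
  moreover have "preserves \<Theta>' \<sigma>"
    unfolding preserves_def
  proof
    fix x assume x: "x \<in> \<sigma>"
    have xl: "length x = n" using sig_length x by blast
    have 1: "vapply \<Theta> x \<in> \<sigma>" using T(2) x by (simp add: preserves_def)
    have 2: "vapply (\<lambda>i. h i ^^ r) x \<in> \<sigma>" using preserves_pow[OF h_preserves] x by (simp add: preserves_def)
    have "vapply \<Theta>' x = ap ((replicate m e)[0 := vapply \<Theta> x, 1 := vapply (\<lambda>i. h i ^^ r) x])"
      using xl by (intro nth_equalityI) (auto simp: map_update \<Theta>'_def)
    also have "\<dots> \<in> \<sigma>" using 1 2 e_sig m0 by (intro ap_sig) (auto simp: set_conv_nth nth_list_update)
    finally show "vapply \<Theta>' x \<in> \<sigma>" .
  qed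
  moreover have "\<Theta>' j (e ! j) = e ! j" if j: "j < n" for j
  proof -
    have "(h j ^^ r) (e ! j) = e ! j" by (induction r) (auto simp: h_e j)
    moreover have "(replicate m (e ! j))[0 := e ! j, 1 := e ! j] = replicate m (e ! j)"
      using m0 by (intro nth_equalityI) (auto simp: nth_list_update)
    ultimately show ?thesis using T(3)[OF j] F_idem[OF j eA[OF j]] by (simp add: \<Theta>'_def)
  qed
  moreover have "\<Theta>' 0 a = (h 0 ^^ Suc r) (a [^]\<^bsub>G\<^esub> Suc r)" if a: "a \<in> As 0" for a
  proof -
    have pc: "a [^]\<^bsub>G\<^esub> r \<in> As 0" using a G.nat_pow_closed[of a r] by simp
    have "\<Theta>' 0 a = plus (h 0 ((h 0 ^^ r) (a [^]\<^bsub>G\<^esub> r))) (h 0 ((h 0 ^^ r) a))"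
      unfolding \<Theta>'_def T(4)[OF a] using pc a by (intro F_two h_pow_closed)
    also have "\<dots> = (h 0 ^^ Suc r) (plus (a [^]\<^bsub>G\<^esub> r) a)"
      using h_pow_plus[OF pc a, of "Suc r"] by simp
    finally show ?thesis by simp
  qed
  ultimately show ?case by blast
qed

text \<open>The polynomial for \<open>r\<close> sends \<open>e[0 := z]\<close>, which is outside
  \<sigma>, to \<open>e\<close>. If it kept \<open>e[0 := w]\<close> outside \<sigma>, it would
  reflect membership in \<sigma>, which is a contradiction.\<close>

lemma torsion_uniform:
  assumes z: "z \<in> As 0" "z \<noteq> e ! 0" "z [^]\<^bsub>G\<^esub> (r::nat) = \<one>\<^bsub>G\<^esub>" and w: "w \<in> As 0"
  shows "w [^]\<^bsub>G\<^esub> r = \<one>\<^bsub>G\<^esub>"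
proof (rule ccontr)
  assume nw: "w [^]\<^bsub>G\<^esub> r \<noteq> \<one>\<^bsub>G\<^esub>"
  obtain \<Theta> where T: "uvf A n \<Theta>" "preserves \<Theta> \<sigma>" "\<And>j. j < n \<Longrightarrow> \<Theta> j (e ! j) = e ! j"
    "\<And>a. a \<in> As 0 \<Longrightarrow> \<Theta> 0 a = (h 0 ^^ r) (a [^]\<^bsub>G\<^esub> r)" using multiple_polynomial by blast
  have va: "vapply \<Theta> (e[0 := a]) = e[0 := (h 0 ^^ r) (a [^]\<^bsub>G\<^esub> r)]" if "a \<in> As 0" for a
    using T(4)[OF that] n0 vapply_ident[of e \<Theta>, OF T(3)] by (simp add: vapply_list_update)
  have D0: "e[0 := a] \<in> D" if "a \<in> As 0" for a using D_update eD that by blast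
  have out: "e[0 := a] \<notin> \<sigma>" if "a \<in> As 0" "a \<noteq> e ! 0" for a
    using sig_iff_sol[OF D0[OF that(1)]] that n0 by (simp add: sol_update_0 sol_e)
  have pw: "w [^]\<^bsub>G\<^esub> r \<in> As 0" using w G.nat_pow_closed[of w r] by simp
  have "w \<noteq> e ! 0"
  proof
    assume "w = e ! 0"
    hence "w [^]\<^bsub>G\<^esub> r = \<one>\<^bsub>G\<^esub>" using G.nat_pow_one[of r] by simp
    thus False using nw by simp
  qed
  hence K: "K (e[0 := w])" using D_key D0 out w by blast
  have "(h 0 ^^ r) (w [^]\<^bsub>G\<^esub> r) \<noteq> e ! 0" using h_pow_eq_e[OF pw] nw by auto
  hence nk: "vapply \<Theta> (e[0 := w]) \<notin> \<sigma>" using va[OF w] out h_pow_closed[OF pw] by simp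
  have "vapply \<Theta> (e[0 := z]) \<in> \<sigma>" using va[OF z(1)] z(3) h_pow_e e_sig by simp
  hence "e[0 := z] \<in> \<sigma>" using reflects_if_not_kill[OF K T(1,2) nk D_B[OF D0[OF z(1)]]] by blast
  thus False using out z by blast
qed

lemma prime_exponent:
  "\<exists>p::nat. Factorial_Ring.prime p \<and> (\<forall>w\<in>carrier G. w [^]\<^bsub>G\<^esub> p = \<one>\<^bsub>G\<^esub>)"
proof -
  obtain z where z: "z \<in> As 0" "e[0 := z] \<notin> \<sigma>" using line_not_full[OF eD n0(1)] by metis
  have z0: "z \<noteq> e ! 0" using z e_sig by auto
  have fG: "finite (carrier G)" using fin_As n0 by simp
  \<comment> \<open>If \<open>p = a * b\<close> and the \<open>a\<close>-th power of
    \<open>z\<close> is nontrivial, that power is annihilated by \<open>b\<close>. By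
    \<open>torsion_uniform\<close> so is \<open>z\<close>, and \<open>p\<close> divides
    \<open>b\<close>.\<close>
  define p where "p = G.ord z"
  have zc: "z \<in> carrier G" using z by simp
  have pz: "z [^]\<^bsub>G\<^esub> p = \<one>\<^bsub>G\<^esub>" unfolding p_def using zc by (rule G.pow_ord_eq_1)
  have p0: "p > 0" unfolding p_def using G.ord_ge_1[OF fG zc] by simp
  have p1: "p \<noteq> 1" unfolding p_def using G.ord_eq_1[OF zc] z0 by simp
  have "Factorial_Ring.prime p"
    unfolding prime_nat_iff
  proof (intro conjI allI impI)
    show "1 < p" using p0 p1 by linarith
    fix a assume a: "a dvd p"
    then obtain b where ab: "p = a * b" by (metis dvdE)
    show "a = 1 \<or> a = p"
    proof (cases "z [^]\<^bsub>G\<^esub> a = \<one>\<^bsub>G\<^esub>")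
      case True
      hence "p dvd a" using G.pow_eq_id[OF zc] by (simp add: p_def)
      thus ?thesis using a by (simp add: dvd_antisym)
    next
      case False
      have zac: "z [^]\<^bsub>G\<^esub> a \<in> As 0" using G.nat_pow_closed[OF zc, of a] by simp
      have "(z [^]\<^bsub>G\<^esub> a) [^]\<^bsub>G\<^esub> b = \<one>\<^bsub>G\<^esub>" using G.nat_pow_pow[OF zc] pz ab by simp
      moreover have "z [^]\<^bsub>G\<^esub> a \<noteq> e ! 0" using False by simp
      ultimately have "z [^]\<^bsub>G\<^esub> b = \<one>\<^bsub>G\<^esub>" using torsion_uniform[OF zac] z(1) by blast
      hence "p dvd b" using G.pow_eq_id[OF zc] by (simp add: p_def)
      hence "b = p" using ab by (simp add: dvd_antisym)
      thus ?thesis using ab p0 by simp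
    qed
  qed
  moreover have "w [^]\<^bsub>G\<^esub> p = \<one>\<^bsub>G\<^esub>" if "w \<in> carrier G" for w
    using torsion_uniform[OF z(1) z0 pz] that by simp
  ultimately show ?thesis by blast
qed

end

text \<open>Any member of \<open>Q\<close> can serve as base point; the conclusion no longer refers
  to it.\<close>

lemma (in wnu_block) block_linear:
  obtains G :: "'a monoid" and p :: nat and \<phi> where "comm_group G" "finite (carrier G)"
    "carrier G \<noteq> {\<one>\<^bsub>G\<^esub>}" "Factorial_Ring.prime p"
    "\<forall>w\<in>carrier G. w [^]\<^bsub>G\<^esub> p = \<one>\<^bsub>G\<^esub>"
    "\<forall>i<n. bij_betw (\<phi> i) (As i) (carrier G)"
    "Q = {x \<in> D. finprod G (\<lambda>i. \<phi> i (x ! i)) {..<n} = \<one>\<^bsub>G\<^esub>}"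
proof -
  obtain \<beta> where b: "\<beta> \<in> D" using D_nonmember by blast
  have n0: "0 < n" using n3 by simp
  obtain c where c: "c \<in> As 0" "\<beta>[0 := c] \<in> \<sigma>" using line[OF b n0] .
  interpret pointed_wnu_block A n \<sigma> B m F As "\<beta>[0 := c]"
    using c D_update[OF b] by unfold_locales blast
  obtain p :: nat where p: "Factorial_Ring.prime p" "\<forall>w\<in>carrier G. w [^]\<^bsub>G\<^esub> p = \<one>\<^bsub>G\<^esub>" using prime_exponent by blast
  have "Q = {x \<in> D. finprod G (\<lambda>i. \<phi> i (x ! i)) {..<n} = \<one>\<^bsub>G\<^esub>}"
    using sig_iff_finprod by blast
  moreover have "finite (carrier G)" using fin_As n0 by simp
  moreover have "carrier G \<noteq> {\<one>\<^bsub>G\<^esub>}"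
  proof -
    obtain z where "z \<in> As 0" "\<beta>[0 := z] \<notin> \<sigma>" using line_not_full[OF b n0(1)] by metis
    hence "z \<noteq> c" using c by blast
    thus ?thesis using \<open>z \<in> As 0\<close> D_length[OF b] n0 by auto
  qed
  moreover have "\<forall>i<n. bij_betw (\<phi> i) (As i) (carrier G)" using phi_bij by blast
  ultimately show ?thesis using that[of G p \<phi>] comm_group_G p by blast
qed

section \<open>Coordinates in a finite field\<close>

lemma finsum_hom_finprod:
  assumes G: "comm_group G" and R: "abelian_group R" and f: "f \<in> hom G (add_monoid R)"
    and I: "finite I" and a: "a \<in> I \<rightarrow> carrier G"
  shows "finsum R (\<lambda>i. f (a i)) I = f (finprod G a I)"
proof -
  interpret G: comm_group G by fact
  interpret R: abelian_group R by fact
  have one: "f \<one>\<^bsub>G\<^esub> = \<zero>\<^bsub>R\<^esub>"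
    using hom_one[OF f G.is_group R.add.is_group] by simp
  show ?thesis
    using I a
  proof (induction I rule: finite_induct)
    case empty thus ?case by (simp add: one)
  next
    case (insert x I)
    have fa: "f (a i) \<in> carrier R" if "i \<in> insert x I" for i
      using hom_in_carrier[OF f, of "a i"] insert.prems that by auto
    have "finsum R (\<lambda>i. f (a i)) (insert x I) = f (a x) \<oplus>\<^bsub>R\<^esub> finsum R (\<lambda>i. f (a i)) I"
      using insert.hyps fa by (intro R.finsum_insert) auto
    also have "\<dots> = f (a x) \<oplus>\<^bsub>R\<^esub> f (finprod G a I)" using insert by simp
    also have "\<dots> = f (a x \<otimes>\<^bsub>G\<^esub> finprod G a I)"
      using hom_mult[OF f, of "a x" "finprod G a I"] insert.prems by (simp add: G.finprod_closed)
    also have "a x \<otimes>\<^bsub>G\<^esub> finprod G a I = finprod G a (insert x I)"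
      using insert by (intro G.finprod_insert[symmetric]) auto
    finally show ?case .
  qed
qed

text \<open>The additive group of a field with \<open>p ^ k\<close> elements and characteristic
  \<open>p\<close> is elementary abelian of the order of \<open>G\<close>. An injection into
  \<open>nat\<close> then replaces the type inherited from the algebraic closure.\<close>

lemma elementary_abelian_iso_field:
  fixes p :: nat
  assumes G: "comm_group G" "finite (carrier G)" "carrier G \<noteq> {\<one>\<^bsub>G\<^esub>}"
    and p: "Factorial_Ring.prime p" and ex: "\<And>x. x \<in> carrier G \<Longrightarrow> x [^]\<^bsub>G\<^esub> p = \<one>\<^bsub>G\<^esub>"
  shows "\<exists>(R :: nat ring) f. field R \<and> finite (carrier R) \<and> f \<in> iso G (add_monoid R)"
proof -
  interpret G: comm_group G by fact
  obtain k where k: "order G = p ^ k" using G.order_prime_power_if_exponent[OF G(2) p ex] by blast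
  have "k \<ge> 1"
  proof (rule ccontr)
    assume "\<not> k \<ge> 1"
    hence "card (carrier G) = 1" using k by (simp add: order_def)
    then obtain z where "carrier G = {z}" by (rule card_1_singletonE)
    thus False using G(3) G.one_closed by auto
  qed
  then obtain F :: "((int list \<times> nat) multiset \<Rightarrow> int) ring" where
    F: "field F" "card (carrier F) = p ^ k" "\<And>x. x \<in> carrier F \<Longrightarrow> add_pow F p x = \<zero>\<^bsub>F\<^esub>"
    using finite_field_exists[OF p] by blast
  interpret F: field F by fact
  have finF: "finite (carrier F)" using F(2) prime_gt_0_nat[OF p] by (intro card_ge_0_finite) simp
  have "\<exists>\<psi>. \<psi> \<in> iso G (add_monoid F)"
  proof (rule elementary_abelian_iso[OF G(1,2) _ _ _ p ex])
    show "comm_group (add_monoid F)" by (rule F.a_comm_group)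
    show "x [^]\<^bsub>add_monoid F\<^esub> p = \<one>\<^bsub>add_monoid F\<^esub>" if "x \<in> carrier (add_monoid F)" for x
      using F(3)[of x] that by (simp add: add_pow_def)
  qed (use finF F(2) k in \<open>simp_all add: order_def\<close>)
  then obtain \<psi> where psi: "\<psi> \<in> iso G (add_monoid F)" by blast
  obtain \<iota> :: "_ \<Rightarrow> nat" where \<iota>: "inj_on \<iota> (carrier F)"
    using finite_imp_inj_to_nat_seg[OF finF] by blast
  define R where "R = image_ring \<iota> F"
  have "field R" unfolding R_def by (rule F.inj_imp_image_ring_is_field[OF \<iota>])
  have "\<iota> \<in> ring_iso F R" unfolding R_def by (rule inj_imp_image_ring_iso[OF \<iota>])
  hence "\<iota> \<in> iso (add_monoid F) (add_monoid R)"
    by (auto simp: ring_iso_def iso_def hom_def ring_hom_def)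
  with psi have "\<iota> \<circ> \<psi> \<in> iso G (add_monoid R)" by (rule iso_set_trans)
  moreover have "finite (carrier R)" using finF by (simp add: R_def image_ring_carrier)
  ultimately show ?thesis using \<open>field R\<close> by blast
qed

theorem mainTheorem13:
  fixes A :: "'a set" and n :: nat and \<sigma> :: "'a list set" and As :: "nat \<Rightarrow> 'a set"
  assumes "finite A" and "n \<ge> 3"
    and "\<exists>\<rho>. key_relation A n \<rho> \<and> essential A n \<rho> \<and> is_core A n \<rho> \<sigma>"
    and "full_pattern A n \<sigma>"
    and "\<exists>m F. wnu_vf_preserves A n m F \<sigma>"
    and "\<forall>i<n. As i \<subseteq> A"
    and "key_block A n \<sigma> (prod_set n As)"
  shows "\<exists>(R :: nat ring) (\<phi> :: nat \<Rightarrow> 'a \<Rightarrow> nat). field R \<and> finite (carrier R) \<and>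
           (\<forall>i<n. bij_betw (\<phi> i) (As i) (carrier R)) \<and>
           \<sigma> \<inter> prod_set n As =
             {xs \<in> prod_set n As. finsum R (\<lambda>i. \<phi> i (xs ! i)) {..<n} = \<zero>\<^bsub>R\<^esub>}"
proof -
  obtain \<rho> where rho: "essential A n \<rho>" "is_core A n \<rho> \<sigma>" using assms(3) by blast
  obtain m F where F: "wnu_vf_preserves A n m F \<sigma>" using assms(5) by blast
  obtain B where "core_relation A n \<sigma> B"
    using core_relation_if_is_core[OF assms(1) _ rho] assms(2) by auto
  then interpret wnu_block A n \<sigma> B m F As
    by (rule wnu_block.intro) (rule wnu_block_axioms.intro[OF assms(2,4) F assms(7)])
  obtain G :: "'a monoid" and p :: nat and \<phi> where G: "comm_group G" "finite (carrier G)"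
    "carrier G \<noteq> {\<one>\<^bsub>G\<^esub>}" and p: "Factorial_Ring.prime p"
    and ex: "\<forall>w\<in>carrier G. w [^]\<^bsub>G\<^esub> p = \<one>\<^bsub>G\<^esub>"
    and phi: "\<forall>i<n. bij_betw (\<phi> i) (As i) (carrier G)"
    and eq: "\<sigma> \<inter> prod_set n As = {x \<in> prod_set n As. finprod G (\<lambda>i. \<phi> i (x ! i)) {..<n} = \<one>\<^bsub>G\<^esub>}"
    by (rule block_linear)
  obtain R :: "nat ring" and f where R: "field R" "finite (carrier R)" and f: "f \<in> iso G (add_monoid R)"
    using elementary_abelian_iso_field[OF G p] ex by blast
  interpret G: comm_group G by fact
  interpret R: field R by fact
  have fh: "f \<in> hom G (add_monoid R)" and fb: "bij_betw f (carrier G) (carrier R)"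
    using f by (auto simp: iso_def)
  have f1: "f x = \<zero>\<^bsub>R\<^esub> \<longleftrightarrow> x = \<one>\<^bsub>G\<^esub>" if "x \<in> carrier G" for x
  proof -
    have "f \<one>\<^bsub>G\<^esub> = \<zero>\<^bsub>R\<^esub>" using hom_one[OF fh G.is_group R.add.is_group] by simp
    thus ?thesis using fb that by (metis G.one_closed bij_betw_def inj_on_eq_iff)
  qed
  have "finsum R (\<lambda>i. (f \<circ> \<phi> i) (x ! i)) {..<n} = \<zero>\<^bsub>R\<^esub> \<longleftrightarrow> finprod G (\<lambda>i. \<phi> i (x ! i)) {..<n} = \<one>\<^bsub>G\<^esub>"
    if x: "x \<in> prod_set n As" for x
  proof -
    have a: "(\<lambda>i. \<phi> i (x ! i)) \<in> {..<n} \<rightarrow> carrier G"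
      using x phi bij_betwE by (fastforce simp: mem_prod_set_iff)
    show ?thesis
      using finsum_hom_finprod[OF G(1) R.abelian_group_axioms fh _ a] f1[OF G.finprod_closed[OF a]] by simp
  qed
  hence "\<sigma> \<inter> prod_set n As = {xs \<in> prod_set n As. finsum R (\<lambda>i. (f \<circ> \<phi> i) (xs ! i)) {..<n} = \<zero>\<^bsub>R\<^esub>}"
    using eq by blast
  moreover have "\<forall>i<n. bij_betw (f \<circ> \<phi> i) (As i) (carrier R)"
    using bij_betw_trans[OF _ fb] phi by blast
  ultimately show ?thesis using R by (intro exI[of _ R] exI[of _ "\<lambda>i. f \<circ> \<phi> i"]) simp
qed

end
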